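(* Let $0<p_B\le p_A\le1$, let $(X_n)_{n\ge0}$ be the two-armed bandit algorithm with parameters $p_A,p_B$ and step sequence $(\gamma_n)_{n\ge1}$ (defined in the context), and let $X_\infty$ be the a.s. limit of $X_n$. (a) Let $\gamma_n=\left(\frac{C}{n+C}\right)^\alpha$, $n\ge1$, with $0<\alpha\le1$ and $C>0$. Then $\mathbb{P}_x(X_\infty=0)=0$ for every $x\in(0,1]$ if and only if $$\alpha=1\quad\text{and}\quad C\le\frac1{p_B}.$$ (b) Let $\gamma_n=\frac{\Delta_n}{1+\Delta_1+\cdots+\Delta_n}$, $n\ge1$, where $(\Delta_n)_{n\ge1}$ is a sequence of positive real numbers satisfying $\Delta_n\sim C\,n^{1/p_B-1}(\log n)^\alpha$ as $n\to\infty$ for some $\alpha>0$ and $C>0$. These steps satisfy $\gamma_n\in(0,1)$ and $\sum_n\gamma_n=+\infty$, since $\gamma_n\sim\frac1{np_B}$. Then $\mathbb{P}_x(X_\infty=0)=0$ for every $x\in(0,1]$ if and only if $$\alpha\le\frac1{p_B}.$$ (c) In particular, if $0<p_B<p_A\le1$, the two-armed bandit algorithm is a.s. infallible, i.e. $\mathbb{P}_x(X_\infty=1)=1$ for every $x\in(0,1]$, for the step sequences of (a) with $\alpha=1$, $C\le 1/p_B$ and for those of (b) with $\alpha\le1/p_B$. The step sequence $\gamma_n=\frac1{n+1}$, $n\ge1$ (i.e. $\alpha=1$, $C=1$), satisfies the condition of (a) regardless of the value of $p_B$.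
   Context: Two-armed bandit algorithm: let $(U_n)_{n\ge1}$ be i.i.d. random variables uniformly distributed on $[0,1]$, and let $(A_n)_{n\ge1},(B_n)_{n\ge1}$ be events such that $(\mathbf 1_{A_n},\mathbf 1_{B_n})_{n\ge1}$ is an i.i.d. sequence, independent of $(U_n)_{n\ge1}$, with $\mathbb{P}(A_1)=p_A$ and $\mathbb{P}(B_1)=p_B$. The steps satisfy $\gamma_n\in(0,1)$ for all $n\ge1$ and $\sum_n\gamma_n=+\infty$. The algorithm starting from $x\in[0,1]$ is defined by $X_0=x$ and, for $n\ge0$, $$X_{n+1}=X_n+\gamma_{n+1}\big((1-X_n)\mathbf 1_{\{U_{n+1}\le X_n\}\cap A_{n+1}}-X_n\mathbf 1_{\{U_{n+1}>X_n\}\cap B_{n+1}}\big).$$ $\mathbb{P}_x$ denotes probability when $X_0=x$. The a.s. limit $X_\infty=\lim_nX_n$ exists, since $(X_n)$ is a $[0,1]$-valued submartingale. The notation $a_n\sim b_n$ means $a_n/b_n\to1$. *)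

theory Defs
  imports "HOL-Probability.Probability" "HOL-Library.Landau_Symbols"
begin

text \<open>All sequences of the model are indexed from 1; their values at index 0 are never used.\<close>

definition indicator_pair ::
  "(nat \<Rightarrow> 'a set) \<Rightarrow> (nat \<Rightarrow> 'a set) \<Rightarrow> nat \<Rightarrow> 'a \<Rightarrow> real \<times> real" where
  "indicator_pair A B n \<omega> = (indicator (A n) \<omega>, indicator (B n) \<omega>)"

text \<open>\<^const>\<open>prob_space.indep_var\<close> requires both random variables to have the same value type,
  so the independence of the two sequences is expressed through the sigma-algebras they generate.
  No relation between \<open>A n\<close> and \<open>B n\<close> for the same \<open>n\<close> is imposed.\<close>

locale bandit_environment = prob_space M
  for M :: "'a measure" +
  fixes U :: "nat \<Rightarrow> 'a \<Rightarrow> real"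
    and A B :: "nat \<Rightarrow> 'a set"
    and pA pB :: real
  assumes U_indep: "indep_vars (\<lambda>_. borel) U {1..}"
    and U_uniform: "\<And>n. n \<ge> 1 \<Longrightarrow> distr M borel (U n) = uniform_measure lborel {0..1}"
    and A_events: "\<And>n. n \<ge> 1 \<Longrightarrow> A n \<in> events"
    and B_events: "\<And>n. n \<ge> 1 \<Longrightarrow> B n \<in> events"
    and AB_indep: "indep_vars (\<lambda>_. borel) (indicator_pair A B) {1..}"
    and AB_ident: "\<And>n. n \<ge> 1 \<Longrightarrow>
      distr M borel (indicator_pair A B n) = distr M borel (indicator_pair A B 1)"
    and U_AB_indep: "indep_set
      (sets (vimage_algebra (space M) (\<lambda>\<omega>. \<lambda>n\<in>{1..}. U n \<omega>) (\<Pi>\<^sub>M n\<in>{1..}. borel)))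
      (sets (vimage_algebra (space M) (\<lambda>\<omega>. \<lambda>n\<in>{1..}. indicator_pair A B n \<omega>)
        (\<Pi>\<^sub>M n\<in>{1..}. borel)))"
    and prob_A: "prob (A 1) = pA"
    and prob_B: "prob (B 1) = pB"

definition admissible_steps :: "(nat \<Rightarrow> real) \<Rightarrow> bool" where
  "admissible_steps \<gamma> \<longleftrightarrow> (\<forall>n\<ge>1. 0 < \<gamma> n \<and> \<gamma> n < 1) \<and>
     filterlim (\<lambda>n. \<Sum>k=1..n. \<gamma> k) at_top at_top"

primrec bandit ::
  "(nat \<Rightarrow> real) \<Rightarrow> (nat \<Rightarrow> 'a \<Rightarrow> real) \<Rightarrow> (nat \<Rightarrow> 'a set) \<Rightarrow> (nat \<Rightarrow> 'a set) \<Rightarrow>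
    real \<Rightarrow> nat \<Rightarrow> 'a \<Rightarrow> real" where
  "bandit \<gamma> U A B x 0 = (\<lambda>\<omega>. x)"
| "bandit \<gamma> U A B x (Suc n) = (let X = bandit \<gamma> U A B x n in
     (\<lambda>\<omega>. X \<omega> + \<gamma> (Suc n) *
       ((1 - X \<omega>) * indicator ({\<omega>'. U (Suc n) \<omega>' \<le> X \<omega>'} \<inter> A (Suc n)) \<omega>
        - X \<omega> * indicator ({\<omega>'. U (Suc n) \<omega>' > X \<omega>'} \<inter> B (Suc n)) \<omega>)))"

text \<open>The limit exists almost surely; on the exceptional null set the value is unspecified.\<close>

definition bandit_limit ::
  "(nat \<Rightarrow> real) \<Rightarrow> (nat \<Rightarrow> 'a \<Rightarrow> real) \<Rightarrow> (nat \<Rightarrow> 'a set) \<Rightarrow> (nat \<Rightarrow> 'a set) \<Rightarrow>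
    real \<Rightarrow> 'a \<Rightarrow> real" where
  "bandit_limit \<gamma> U A B x \<omega> = lim (\<lambda>n. bandit \<gamma> U A B x n \<omega>)"

definition infallible ::
  "'a measure \<Rightarrow> (nat \<Rightarrow> real) \<Rightarrow> (nat \<Rightarrow> 'a \<Rightarrow> real) \<Rightarrow> (nat \<Rightarrow> 'a set) \<Rightarrow> (nat \<Rightarrow> 'a set) \<Rightarrow>
    bool" where
  "infallible M \<gamma> U A B \<longleftrightarrow>
     (\<forall>x\<in>{0<..1}. measure M {\<omega> \<in> space M. bandit_limit \<gamma> U A B x \<omega> = 1} = 1)"

definition power_steps :: "real \<Rightarrow> real \<Rightarrow> nat \<Rightarrow> real" where
  "power_steps C \<alpha> n = (C / (real n + C)) powr \<alpha>"

definition weight_steps :: "(nat \<Rightarrow> real) \<Rightarrow> nat \<Rightarrow> real" where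
  "weight_steps \<Delta> n = \<Delta> n / (1 + (\<Sum>k=1..n. \<Delta> k))"

text \<open>The parameter \<open>p\<close> is the success probability of the inferior arm.\<close>

definition log_weights :: "real \<Rightarrow> real \<Rightarrow> real \<Rightarrow> (nat \<Rightarrow> real) \<Rightarrow> bool" where
  "log_weights p C \<alpha> \<Delta> \<longleftrightarrow> (\<forall>n\<ge>1. 0 < \<Delta> n) \<and>
     \<Delta> \<sim>[at_top] (\<lambda>n. C * real n powr (1 / p - 1) * ln (real n) powr \<alpha>)"

end

theory Submission
  imports Defs "HOL-Real_Asymp.Real_Asymp"
begin

text \<open>
  Put \<open>P\<^sub>n = \<Prod>j\<le>n. (1 - p\<^sub>B \<gamma>\<^sub>j)\<close>; everything hinges on whether \<open>\<Sum>P\<^sub>n\<close> converges.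

  If it converges, then for small \<open>x\<close> arm A is, with positive probability, never played at all: the
  probability that it is ever played is at most \<open>x \<Sum>P\<^sub>n\<close>, and as long as it is not played
  \<open>X\<^sub>n\<close> contributes at most \<open>x P\<^sub>n\<close> to the expectation, so that \<open>X\<^sub>n\<close> tends to 0 almost surely on this event.

  If it diverges while \<open>c / n \<le> \<gamma>\<^sub>n \<le> D / n\<close>, then the transition operators of the Markov chain \<open>X\<close>
  have two explicit supersolutions. The functions \<open>exp (- \<lambda>\<^sub>n x)\<close> with \<open>1 / \<lambda>\<^sub>n = a / n + 1 / L\<close> show that
  \<open>P (X\<^sub>\<infinity> = 0 | X\<^sub>n = x) \<le> exp (- n x / a)\<close>, which is bounded away from 1 right after a win of arm A,
  since then \<open>x \<ge> \<gamma>\<^sub>n\<close>. For the chain killed at such a win, the functions \<open>W\<^sub>n / (1 + x V\<^sub>n)\<close> with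
  \<open>V\<^sub>n = p\<^sub>B / 2 + (1 - p\<^sub>B \<gamma>\<^sub>n\<^sub>+\<^sub>1) V\<^sub>n\<^sub>+\<^sub>1\<close> show that a win occurs almost surely. Hence
  \<open>P (X\<^sub>\<infinity> = 0 | X\<^sub>n) \<le> q\<close> for some constant \<open>q < 1\<close>, which forces \<open>P (X\<^sub>\<infinity> = 0) = 0\<close>.
\<close>

section \<open>The transition operators and their supersolutions\<close>

text \<open>Both supersolutions rest on a second-order expansion of one step. Under
  \<open>exp (- l * x)\<close> the first-order effects of a win and a loss cancel when
  \<open>pA = pB\<close>, and a better arm A only lowers the value; the remaining variance term
  costs \<open>(l * g)^2\<close> in the exponent. The condition on the rates is thus a discrete
  Riccati inequality, and \<open>a / n + 1 / L\<close> for the reciprocal rate is modelled on the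
  solution of the differential equation. For the chain killed at a win, \<open>exp (- x * V)\<close>
  would leave errors of order \<open>(g * x * V)^2\<close>, out of control as V grows. With
  \<open>1 / (1 + x * V)\<close> a loss multiplies the denominator by \<open>1 - g * r\<close>,
  where \<open>r = x * V / (1 + x * V) < 1\<close>, so the error is of order \<open>g^2\<close>
  uniformly in V. Since the squared steps are summable, the accumulated factor W stays bounded while
  V tends to infinity. Conditioning on the past is replaced by splitting events on which the current
  state is constant; each step cuts such an event into four of the same kind.\<close>

definition bandit_step :: "real \<Rightarrow> real \<Rightarrow> real \<Rightarrow> (real \<Rightarrow> real) \<Rightarrow> real \<Rightarrow> real" where
  "bandit_step pA pB g f x =
     x * (pA * f (x + g * (1 - x)) + (1 - pA) * f x) + (1 - x) * (pB * f (x - g * x) + (1 - pB) * f x)"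

text \<open>The conditional expectation of \<open>f (X (n + d))\<close> given
  \<open>X n = x\<close>, unfolded at its first step; hence inductions on d must let n vary.\<close>

primrec bandit_trans ::
  "real \<Rightarrow> real \<Rightarrow> (nat \<Rightarrow> real) \<Rightarrow> nat \<Rightarrow> nat \<Rightarrow> (real \<Rightarrow> real) \<Rightarrow> real \<Rightarrow> real" where
  "bandit_trans pA pB \<gamma> 0 n f = f"
| "bandit_trans pA pB \<gamma> (Suc d) n f =
     bandit_step pA pB (\<gamma> (Suc n)) (bandit_trans pA pB \<gamma> d (Suc n) f)"

lemma win_in_unit: "0 < g \<Longrightarrow> g < 1 \<Longrightarrow> x \<in> {0<..1} \<Longrightarrow> x + g * (1 - x) \<in> {0<..(1::real)}"
  using mult_left_le_one_le[of "1-x" g] by (auto simp: add_pos_nonneg)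

lemma loss_in_unit: "0 < g \<Longrightarrow> g < 1 \<Longrightarrow> x \<in> {0<..1} \<Longrightarrow> x - g * x \<in> {0<..(1::real)}"
  using mult_strict_right_mono[of g 1 x] mult_pos_pos[of g x]
  by (auto simp: greaterThanAtMost_iff simp del: mult_pos_pos zero_less_mult_iff)

lemma bandit_step_mono:
  assumes "0 \<le> pA" "pA \<le> 1" "0 \<le> pB" "pB \<le> 1" "0 < g" "g < 1" "x \<in> {0<..1}"
    and le: "\<And>y. y \<in> {0<..1} \<Longrightarrow> f y \<le> h y"
  shows "bandit_step pA pB g f x \<le> bandit_step pA pB g h x"
  unfolding bandit_step_def
  using assms(1-7) le[OF win_in_unit[OF assms(5-7)]] le[OF loss_in_unit[OF assms(5-7)]] le[OF assms(7)]
  by (intro add_mono mult_left_mono) auto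

lemma bandit_step_const: "bandit_step pA pB g (\<lambda>_. c) x = c"
  by (simp add: bandit_step_def algebra_simps)

text \<open>Backward induction: the operators are monotone, so the terminal bound is carried back to
  time n by one-step inequalities alone. Only states in (0,1] matter, since a win or a loss stays
  there.\<close>

lemma bandit_trans_supersolution:
  assumes p: "0 \<le> pA" "pA \<le> 1" "0 \<le> pB" "pB \<le> 1"
    and g: "\<And>k. k \<ge> 1 \<Longrightarrow> 0 < \<gamma> k \<and> \<gamma> k < 1"
    and step: "\<And>k x. n \<le> k \<Longrightarrow> k < n + d \<Longrightarrow> x \<in> {0<..1} \<Longrightarrow>
      bandit_step pA pB (\<gamma> (Suc k)) (\<phi> (Suc k)) x \<le> \<phi> k x"
    and fin: "\<And>x. x \<in> {0<..1} \<Longrightarrow> f x \<le> \<phi> (n + d) x"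
    and x: "x \<in> {0<..1}"
  shows "bandit_trans pA pB \<gamma> d n f x \<le> \<phi> n x"
  using step fin x
proof (induction d arbitrary: n x)
  case 0
  then show ?case by simp
next
  case (Suc d)
  have "bandit_step pA pB (\<gamma> (Suc n)) (bandit_trans pA pB \<gamma> d (Suc n) f) x
      \<le> bandit_step pA pB (\<gamma> (Suc n)) (\<phi> (Suc n)) x"
    using g[of "Suc n"] Suc.prems by (intro bandit_step_mono[OF p]) (auto intro!: Suc.IH)
  also have "\<dots> \<le> \<phi> n x"
    using Suc.prems by auto
  finally show ?case by simp
qed

lemma bandit_trans_le_one:
  assumes p: "0 \<le> pA" "pA \<le> 1" "0 \<le> pB" "pB \<le> 1"
    and g: "\<And>k. k \<ge> 1 \<Longrightarrow> 0 < \<gamma> k \<and> \<gamma> k < 1"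
    and f: "\<And>x. x \<in> {0<..1} \<Longrightarrow> f x \<le> 1" and x: "x \<in> {0<..1}"
  shows "bandit_trans pA pB \<gamma> d n f x \<le> 1"
  by (rule bandit_trans_supersolution[OF p g, where \<phi> = "\<lambda>_ _. 1"]) (use f x in \<open>auto simp: bandit_step_const\<close>)

section \<open>Exponential supersolutions\<close>

lemma exp_le_quadratic:
  fixes u :: real
  assumes "u \<le> 1"
  shows "exp u \<le> 1 + u + u\<^sup>2"
proof (cases "u \<ge> 0")
  case True
  then show ?thesis using exp_bound assms by auto
next
  case False
  define v where "v = - u"
  have v: "v > 0" using False by (simp add: v_def)
  have e: "1 + v + v\<^sup>2 / 2 \<le> exp v"
    using exp_lower_Taylor_quadratic[of v] v by simp
  \<comment> \<open>Multiplying the claimed bound for \<open>exp (- v)\<close> by a Taylor minorant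
    of \<open>exp v\<close> already gives at least 1. No lower bound on u is thus required, which
    suits the downward jump of the exponent at a win.\<close>
  have "1 \<le> (1 - v + v\<^sup>2) * (1 + v + v\<^sup>2 / 2)"
  proof -
    have "(1 - v + v\<^sup>2) * (1 + v + v\<^sup>2 / 2) = 1 + v\<^sup>2 / 2 + v^3 / 2 + v^4 / 2"
      by (simp add: field_simps power2_eq_square power3_eq_cube power4_eq_xxxx)
    then show ?thesis using v by simp
  qed
  also have "\<dots> \<le> (1 - v + v\<^sup>2) * exp v"
  proof (rule mult_left_mono[OF e])
    have "0 \<le> (1/2 - v)\<^sup>2" by simp
    then show "0 \<le> 1 - v + v\<^sup>2" by (simp add: power2_eq_square algebra_simps)
  qed
  finally show ?thesis
    by (simp add: v_def exp_minus field_simps)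
qed

text \<open>The win term is negative, so \<open>pA\<close> may be lowered to \<open>pB\<close>. Then
  the linear terms \<open>- x * s * (1 - x)\<close> and \<open>(1 - x) * s * x\<close> cancel and
  the quadratic ones add up to \<open>s^2 * x * (1 - x)\<close>. The factor
  \<open>1 + s^2 * x\<close> is absorbed into the exponent, which lowers the rate from
  \<open>l\<close> to \<open>l - s^2\<close>.\<close>

lemma exp_step:
  assumes p: "0 \<le> pB" "pB \<le> pA" "pB \<le> 1" and x: "x \<in> {0..1}"
    and l: "0 \<le> l" "0 \<le> g" "l * g \<le> 1" and le: "m \<le> l - (l * g)\<^sup>2"
  shows "bandit_step pA pB g (\<lambda>x. exp (- l * x)) x \<le> exp (- m * x)"
proof -
  define s where "s = l * g"
  have s: "0 \<le> s" "s \<le> 1" using l by (auto simp: s_def)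
  have x01: "0 \<le> x" "x \<le> 1" using x by auto
  have w: "exp (- l * (x + g * (1 - x))) = exp (- l * x) * exp (- s * (1 - x))"
    by (simp add: s_def exp_add[symmetric] algebra_simps)
  have lo: "exp (- l * (x - g * x)) = exp (- l * x) * exp (s * x)"
    by (simp add: s_def exp_add[symmetric] algebra_simps)
  have "bandit_step pA pB g (\<lambda>x. exp (- l * x)) x =
     exp (- l * x) * (1 + (pA * (x * (exp (- s * (1 - x)) - 1)) + pB * ((1 - x) * (exp (s * x) - 1))))"
    unfolding bandit_step_def w lo by (simp add: algebra_simps)
  also have "\<dots> \<le> exp (- l * x) * (1 + s\<^sup>2 * x)"
  proof (intro mult_left_mono add_left_mono)
    have "x * (exp (- s * (1 - x)) - 1) \<le> 0"
      using s x01 by (intro mult_nonneg_nonpos) auto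
    then have "pA * (x * (exp (- s * (1 - x)) - 1)) \<le> pB * (x * (exp (- s * (1 - x)) - 1))"
      using p by (intro mult_right_mono_neg) auto
    also have "\<dots> \<le> pB * (x * (- s * (1 - x) + (s * (1 - x))\<^sup>2))"
    proof -
      have "- s * (1 - x) \<le> 1" using s x01
        by (smt (verit) mult_nonneg_nonneg mult_minus_left)
      from exp_le_quadratic[OF this] show ?thesis
        using p x01 by (intro mult_left_mono) auto
    qed
    finally have 1: "pA * (x * (exp (- s * (1 - x)) - 1)) \<le> pB * (x * (- s * (1 - x) + (s * (1 - x))\<^sup>2))" .
    have 2: "pB * ((1 - x) * (exp (s * x) - 1)) \<le> pB * ((1 - x) * (s * x + (s * x)\<^sup>2))"
    proof -
      have "s * x \<le> 1" using s x01 by (simp add: mult_le_one)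
      from exp_le_quadratic[OF this] show ?thesis
        using p x01 by (intro mult_left_mono) auto
    qed
    have "pA * (x * (exp (- s * (1 - x)) - 1)) + pB * ((1 - x) * (exp (s * x) - 1)) \<le> pB * (s\<^sup>2 * x * (1 - x))"
      using 1 2 by (simp add: power2_eq_square algebra_simps)
    also have "\<dots> \<le> s\<^sup>2 * x * (1 - x)"
      using p x01 by (intro mult_left_le_one_le mult_nonneg_nonneg) auto
    also have "\<dots> \<le> s\<^sup>2 * x"
      using x01 by (intro mult_left_le mult_nonneg_nonneg) auto
    finally show "pA * (x * (exp (- s * (1 - x)) - 1)) + pB * ((1 - x) * (exp (s * x) - 1)) \<le> s\<^sup>2 * x"
      .
  qed auto
  also have "\<dots> \<le> exp (- l * x) * exp (s\<^sup>2 * x)"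
    using exp_ge_add_one_self by (intro mult_left_mono) auto
  also have "\<dots> = exp (- (l - s\<^sup>2) * x)"
    by (simp add: exp_add[symmetric] algebra_simps)
  also have "\<dots> \<le> exp (- m * x)"
  proof -
    have "m * x \<le> (l - s\<^sup>2) * x" using le x01 unfolding s_def by (intro mult_right_mono) auto
    then show ?thesis by (simp only: exp_le_cancel_iff mult_minus_left neg_le_iff_le)
  qed
  finally show ?thesis .
qed

text \<open>For the reciprocals \<open>b\<close> of the rates the first claim reads
  \<open>b n * g^2 \<le> b (Suc n) * (b n - b (Suc n))\<close>, and the decrement of
  \<open>b\<close> is \<open>a / (n * (n + 1))\<close>. The factor in \<open>2 * D^2 \<le> a\<close>
  pays for \<open>b n \<le> 2 * b (Suc n)\<close>, while \<open>D \<le> a\<close> gives the second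
  claim.\<close>

lemma rate_increment:
  fixes a D L :: real
  assumes n: "n \<ge> 1" and D: "0 < D" "D \<le> a" "2 * D\<^sup>2 \<le> a" and L: "0 < L"
    and g: "0 \<le> g" "g \<le> D / real (Suc n)"
  defines "l \<equiv> \<lambda>n. 1 / (a / real n + 1 / L)"
  shows "l n \<le> l (Suc n) - (l (Suc n) * g)\<^sup>2" and "l (Suc n) * g \<le> 1"
proof -
  define b where "b = (\<lambda>n. a / real n + 1 / L)"
  have a: "a > 0" using D by simp
  have bpos: "b n > 0" "b (Suc n) > 0" using n a L by (auto simp: b_def intro!: add_nonneg_pos)
  have diff: "b n - b (Suc n) = a / (real n * real (Suc n))"
    using n by (simp add: b_def field_simps)
  have g2: "g\<^sup>2 \<le> (D / real (Suc n))\<^sup>2" using g by (intro power_mono) auto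
  have half: "b n \<le> 2 * b (Suc n)"
  proof -
    have "a / real n \<le> 2 * (a / real (Suc n))" using n a by (simp add: field_simps)
    moreover have "0 < 1 / L" using L by simp
    ultimately show ?thesis unfolding b_def distrib_left by linarith
  qed
  have key: "b n * g\<^sup>2 \<le> b (Suc n) * (b n - b (Suc n))"
  proof -
    have "b n * g\<^sup>2 \<le> (2 * b (Suc n)) * (D / real (Suc n))\<^sup>2"
      using half g2 bpos by (intro mult_mono) auto
    also have "\<dots> = b (Suc n) * (2 * D\<^sup>2 / (real (Suc n))\<^sup>2)"
      by (simp add: power_divide)
    also have "2 * D\<^sup>2 / (real (Suc n))\<^sup>2 \<le> a / (real n * real (Suc n))"
      using n D a by (intro frac_le) (auto simp: power2_eq_square intro!: mult_pos_pos)
    finally show ?thesis using bpos by (simp add: diff)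
  qed
  have "1 / b (Suc n) - (1 / b (Suc n) * g)\<^sup>2 - 1 / b n
      = (b (Suc n) * (b n - b (Suc n)) - b n * g\<^sup>2) / (b n * (b (Suc n))\<^sup>2)"
    using bpos by (simp add: field_simps power2_eq_square)
  also have "\<dots> \<ge> 0" using key bpos by simp
  finally show "l n \<le> l (Suc n) - (l (Suc n) * g)\<^sup>2" by (simp add: l_def b_def)
  have "g \<le> a / real (Suc n)" using g D by (smt (verit) divide_right_mono of_nat_0_le_iff)
  also have "\<dots> \<le> b (Suc n)" using L by (simp add: b_def)
  finally show "l (Suc n) * g \<le> 1" using bpos by (simp add: l_def b_def field_simps)
qed

text \<open>The terminal function \<open>exp (- L * x)\<close> stands in for the indicator of the
  state 0. The bound is free of d, so it survives letting the final time tend to infinity.\<close>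

lemma bandit_trans_exp:
  assumes p: "0 \<le> pB" "pB \<le> pA" "pA \<le> 1"
    and g: "\<And>k. k \<ge> 1 \<Longrightarrow> 0 < \<gamma> k \<and> \<gamma> k < 1"
    and D: "0 < D" "D \<le> a" "2 * D\<^sup>2 \<le> a" and L: "0 < L"
    and gD: "\<And>k. k \<ge> 1 \<Longrightarrow> \<gamma> k \<le> D / real k"
    and n: "n \<ge> 1" and x: "x \<in> {0<..1}"
  shows "bandit_trans pA pB \<gamma> d n (\<lambda>x. exp (- L * x)) x \<le> exp (- (1 / (a / real n + 1 / L)) * x)"
proof (rule bandit_trans_supersolution[where \<phi> = "\<lambda>n x. exp (- (1 / (a / real n + 1 / L)) * x)"])
  fix k and x :: real assume k: "n \<le> k" "k < n + d" and x: "x \<in> {0<..1}"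
  have k1: "k \<ge> 1" using k n by simp
  have a: "a > 0" using D by simp
  have b: "0 < a / real (Suc k) + 1 / L" using a L by (auto intro!: add_pos_pos)
  note r = rate_increment[OF k1 D L, of "\<gamma> (Suc k)"]
  show "bandit_step pA pB (\<gamma> (Suc k)) (\<lambda>x. exp (- (1 / (a / real (Suc k) + 1 / L)) * x)) x
      \<le> exp (- (1 / (a / real k + 1 / L)) * x)"
    using p x b g[of "Suc k"] gD[of "Suc k"] by (intro exp_step r) auto
next
  fix x :: real assume x: "x \<in> {0<..1}"
  have "1 / (a / real (n + d) + 1 / L) \<le> 1 / (1 / L)"
    using D L by (intro divide_left_mono) (auto intro!: add_nonneg_pos mult_pos_pos divide_pos_pos)
  then have "(1 / (a / real (n + d) + 1 / L)) * x \<le> 1 / (1 / L) * x"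
    using x by (intro mult_right_mono) auto
  then show "exp (- L * x) \<le> exp (- (1 / (a / real (n + d) + 1 / L)) * x)"
    by simp
qed (use p g x in auto)

text \<open>The left side is one step of the chain killed at a win. Killing removes at least
  \<open>pB * x\<close>, half of which produces the summand \<open>pB / 2\<close> of
  \<open>v\<close>. Taking only half keeps \<open>\<tau> \<le> 1 / 2\<close>, so the main term stays
  at least 1/2 and the additive error \<open>2 * g^2\<close> fits into the factor
  \<open>1 + 4 * g^2\<close>.\<close>

lemma no_win_step:
  fixes x g v v' pA pB :: real
  assumes p: "0 < pB" "pB \<le> pA" "pA \<le> 1" and g: "0 < g" "g \<le> 1 / 2" and x: "x \<in> {0<..1}"
    and v': "0 \<le> v'" and v: "v = pB / 2 + (1 - pB * g) * v'"
  shows "x * (1 - pA) * (1 / (1 + x * v')) +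
      (1 - x) * (pB * (1 / (1 + (x - g * x) * v')) + (1 - pB) * (1 / (1 + x * v')))
    \<le> (1 + 4 * g\<^sup>2) * (1 / (1 + x * v))"
proof -
  define y where "y = x * v'"
  define r where "r = y / (1 + y)"
  define \<tau> where "\<tau> = pB / 2 * x"
  have x01: "0 < x" "x \<le> 1" using x by auto
  have y: "0 \<le> y" using x v' by (simp add: y_def)
  have r: "0 \<le> r" "r < 1" using y by (auto simp: r_def)
  have gr: "g * r \<le> 1 / 2" using mult_mono[of g "1/2" r 1] g r by auto
  have gr0: "0 \<le> g * r" using g r by auto
  \<comment> \<open>This factorization is what the rational form is chosen for: the relative effect
    of a loss is \<open>g * r\<close> with \<open>r < 1\<close>, however large \<open>v'\<close>
    is.\<close>
  have fac: "1 + (x - g * x) * v' = (1 + y) * (1 - g * r)"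
    using y by (simp add: r_def y_def field_simps)
  have gr2: "1 / (1 - g * r) \<le> 1 + g * r + 2 * g\<^sup>2"
  proof -
    have "1 \<le> (1 + g * r + 2 * (g * r)\<^sup>2) * (1 - g * r)"
    proof -
      have "(1 + g * r + 2 * (g * r)\<^sup>2) * (1 - g * r) = 1 + (g * r)\<^sup>2 * (1 - 2 * (g * r))"
        by (simp add: power2_eq_square algebra_simps)
      then show ?thesis using gr by simp
    qed
    then have "1 / (1 - g * r) \<le> 1 + g * r + 2 * (g * r)\<^sup>2" using gr by (simp add: field_simps)
    also have "(g * r)\<^sup>2 \<le> g\<^sup>2" using r g gr0 by (intro power_mono mult_left_le) auto
    finally show ?thesis by simp
  qed
  have \<tau>: "0 \<le> \<tau>" "\<tau> \<le> 1 / 2" "2 * \<tau> \<le> pA * x"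
    using p x01 mult_mono[of "pB/2" "1/2" x 1] by (auto simp: \<tau>_def)
  have "x * (1 - pA) * (1 / (1 + x * v')) +
      (1 - x) * (pB * (1 / (1 + (x - g * x) * v')) + (1 - pB) * (1 / (1 + x * v')))
     = (x * (1 - pA) + (1 - x) * (pB * (1 / (1 - g * r)) + (1 - pB))) / (1 + y)"
    unfolding fac y_def[symmetric] using y gr by (simp add: divide_simps)
  also have "\<dots> \<le> ((1 + 4 * g\<^sup>2) * (1 + pB * (g * r) - \<tau>)) / (1 + y)"
  proof (rule divide_right_mono)
    have "x * (1 - pA) + (1 - x) * (pB * (1 / (1 - g * r)) + (1 - pB))
       \<le> x * (1 - pA) + (1 - x) * (pB * (1 + g * r + 2 * g\<^sup>2) + (1 - pB))"
      using gr2 p x01 by (intro add_left_mono mult_left_mono add_right_mono) auto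
    also have "\<dots> = 1 - pA * x + (1 - x) * (pB * (g * r + 2 * g\<^sup>2))"
      by (simp add: algebra_simps)
    also have "(1 - x) * (pB * (g * r + 2 * g\<^sup>2)) \<le> 1 * (pB * (g * r + 2 * g\<^sup>2))"
      using x01 p gr0 by (intro mult_right_mono) auto
    also have "pB * (g * r + 2 * g\<^sup>2) \<le> pB * (g * r) + 2 * g\<^sup>2"
    proof -
      have "pB * g\<^sup>2 \<le> 1 * g\<^sup>2" using p by (intro mult_right_mono) auto
      then show ?thesis by (simp add: algebra_simps)
    qed
    finally have 1: "x * (1 - pA) + (1 - x) * (pB * (1 / (1 - g * r)) + (1 - pB))
       \<le> 1 - pA * x + (pB * (g * r) + 2 * g\<^sup>2)" by simp
    have "0 \<le> pB * (g * r)" using p gr0 by simp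
    then have "1 / 2 \<le> 1 + pB * (g * r) - \<tau>" using \<tau>(2) by linarith
    then have "4 * g\<^sup>2 * (1 / 2) \<le> 4 * g\<^sup>2 * (1 + pB * (g * r) - \<tau>)"
      by (intro mult_left_mono) auto
    then have 2: "1 + pB * (g * r) - \<tau> + 2 * g\<^sup>2 \<le> (1 + 4 * g\<^sup>2) * (1 + pB * (g * r) - \<tau>)"
      by (simp add: algebra_simps)
    show "x * (1 - pA) + (1 - x) * (pB * (1 / (1 - g * r)) + (1 - pB))
        \<le> (1 + 4 * g\<^sup>2) * (1 + pB * (g * r) - \<tau>)"
      using 1 2 \<tau> by linarith
  qed (use y in auto)
  also have "\<dots> \<le> (1 + 4 * g\<^sup>2) * (1 / (1 + x * v))"
  proof -
    have v0: "0 \<le> v" using p g v' mult_mono[of pB 1 g 1] unfolding v by auto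
    have xv: "0 < 1 + x * v" using x01 v0 by (simp add: add_pos_nonneg)
    have eq: "1 + x * v = 1 + y + \<tau> - pB * g * y"
      by (simp add: v y_def \<tau>_def algebra_simps)
    have le: "(1 + pB * (g * r) - \<tau>) \<le> (1 + y) / (1 + x * v)"
    proof -
      \<comment> \<open>The decrease of the denominator when \<open>v'\<close> is replaced by
        \<open>v\<close>; the bound needed is the tangent inequality for the reciprocal at
        \<open>1 + y\<close>.\<close>
      define d where "d = pB * g * y - \<tau>"
      have xd: "1 + x * v = 1 + y - d" using eq by (simp add: d_def)
      have "(1 + d / (1 + y)) * (1 + y - d) = 1 + y - d\<^sup>2 / (1 + y)"
        using y by (simp add: field_simps power2_eq_square)
      also have "\<dots> \<le> 1 + y" using y by simp
      finally have "1 + d / (1 + y) \<le> (1 + y) / (1 + x * v)"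
        using xv unfolding xd by (simp only: pos_le_divide_eq)
      moreover have "d / (1 + y) = pB * (g * r) - \<tau> / (1 + y)"
        by (simp add: d_def r_def diff_divide_distrib)
      moreover have "\<tau> / (1 + y) \<le> \<tau>" using \<tau> y by (simp add: divide_le_eq algebra_simps)
      ultimately show ?thesis by linarith
    qed
    have "(1 + 4 * g\<^sup>2) * (1 + pB * (g * r) - \<tau>) / (1 + y) \<le> (1 + 4 * g\<^sup>2) * ((1 + y) / (1 + x * v)) / (1 + y)"
      using le y by (intro divide_right_mono mult_left_mono) auto
    also have "\<dots> = (1 + 4 * g\<^sup>2) * (1 / (1 + x * v))" using y by simp
    finally show ?thesis .
  qed
  finally show ?thesis .
qed

text \<open>The V of the overview with horizon d. It vanishes at the horizon, where the survival
  probability is bounded trivially by 1.\<close>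

primrec survival_weight :: "real \<Rightarrow> (nat \<Rightarrow> real) \<Rightarrow> nat \<Rightarrow> nat \<Rightarrow> real" where
  "survival_weight pB \<gamma> 0 n = 0"
| "survival_weight pB \<gamma> (Suc d) n = pB / 2 + (1 - pB * \<gamma> (Suc n)) * survival_weight pB \<gamma> d (Suc n)"

lemma survival_weight_eq:
  "survival_weight pB \<gamma> d n = pB / 2 * (\<Sum>k<d. \<Prod>j<k. 1 - pB * \<gamma> (Suc (n + j)))"
proof (induction d arbitrary: n)
  case 0
  then show ?case by simp
next
  case (Suc d)
  have "(\<Sum>k<Suc d. \<Prod>j<k. 1 - pB * \<gamma> (Suc (n + j))) =
      1 + (1 - pB * \<gamma> (Suc n)) * (\<Sum>k<d. \<Prod>j<k. 1 - pB * \<gamma> (Suc (Suc n + j)))"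
    by (simp only: sum.lessThan_Suc_shift prod.lessThan_Suc_shift sum_distrib_left) simp
  then show ?case unfolding survival_weight.simps Suc.IH
    by (simp only: distrib_left mult.left_commute mult_1_right)
qed

lemma shrink_factor_pos:
  fixes p g :: real
  assumes "p \<le> 1" "0 < g" "g < 1"
  shows "0 < 1 - p * g"
proof -
  have "p * g \<le> 1 * g" using assms by (intro mult_right_mono) auto
  with assms show ?thesis by linarith
qed

lemma survival_weight_nonneg:
  assumes "0 \<le> pB" "pB \<le> 1" "\<And>k. k \<ge> 1 \<Longrightarrow> 0 < \<gamma> k \<and> \<gamma> k < 1"
  shows "0 \<le> survival_weight pB \<gamma> d n"
proof -
  have "0 \<le> 1 - pB * \<gamma> (Suc k)" for k
    using shrink_factor_pos[of pB "\<gamma> (Suc k)"] assms(2) assms(3)[of "Suc k"] by simp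
  then show ?thesis
    unfolding survival_weight_eq using assms by (intro mult_nonneg_nonneg sum_nonneg prod_nonneg) auto
qed

text \<open>After the first win at a time \<open>k \<le> L\<close> the state is at least \<open>\<gamma> k \<ge> c / k\<close>, so the exponential
  bound of \<open>bandit_trans_exp\<close> gives the constant term; the second term dominates the probability
  of no win during \<open>d\<close> steps.\<close>

lemma bandit_trans_first_win:
  assumes p: "0 < pB" "pB \<le> pA" "pA \<le> 1"
    and g: "\<And>k. k \<ge> 1 \<Longrightarrow> 0 < \<gamma> k \<and> \<gamma> k < 1"
    and D: "0 < D" "D \<le> a" "2 * D\<^sup>2 \<le> a" and L: "0 < L"
    and gD: "\<And>k. k \<ge> 1 \<Longrightarrow> \<gamma> k \<le> D / real k"
    and c: "0 < c" and gc: "\<And>k. k \<ge> 1 \<Longrightarrow> c / real k \<le> \<gamma> k"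
    and half: "\<And>k. k > n \<Longrightarrow> \<gamma> k \<le> 1 / 2"
    and dL: "real (n + d) \<le> L" and x: "x \<in> {0<..1}"
  shows "bandit_trans pA pB \<gamma> (d + e) n (\<lambda>x. exp (- L * x)) x
    \<le> exp (- c / (a + 1)) + (\<Prod>j<d. 1 + 4 * (\<gamma> (Suc (n + j)))\<^sup>2) / (1 + x * survival_weight pB \<gamma> d n)"
  using half dL x
proof (induction d arbitrary: n x)
  case 0
  have "bandit_trans pA pB \<gamma> e n (\<lambda>x. exp (- L * x)) x \<le> 1"
    using p g L 0 by (intro bandit_trans_le_one) auto
  then show ?case by (simp add: add_increasing)
next
  case (Suc d)
  define f where "f = bandit_trans pA pB \<gamma> (d + e) (Suc n) (\<lambda>x. exp (- L * x))"
  define q where "q = exp (- c / (a + 1))"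
  define W where "W = (\<Prod>j<d. 1 + 4 * (\<gamma> (Suc (Suc n + j)))\<^sup>2)"
  define v where "v = survival_weight pB \<gamma> d (Suc n)"
  define h where "h = \<gamma> (Suc n)"
  have h: "0 < h" "h \<le> 1 / 2" "h < 1" using g[of "Suc n"] Suc.prems(1)[of "Suc n"] by (auto simp: h_def)
  have x01: "0 < x" "x \<le> 1" using Suc.prems by auto
  have W: "0 \<le> W" unfolding W_def by (intro prod_nonneg) (auto intro: add_nonneg_nonneg)
  have v: "0 \<le> v" unfolding v_def using p g by (intro survival_weight_nonneg) auto
  have IH: "f y \<le> q + W * (1 / (1 + y * v))" if "y \<in> {0<..1}" for y
    unfolding f_def W_def q_def v_def using Suc.IH[of "Suc n" y] that Suc.prems by simp
  have win: "f (x + h * (1 - x)) \<le> q"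
  proof -
    have "f (x + h * (1 - x)) \<le> exp (- (1 / (a / real (Suc n) + 1 / L)) * (x + h * (1 - x)))"
      unfolding f_def using p g D L gD win_in_unit[of h x] h Suc.prems
      by (intro bandit_trans_exp) auto
    also have "\<dots> \<le> q"
    proof -
      have "0 \<le> x * (1 - h)" using x01 h by simp
      then have "c / real (Suc n) \<le> x + h * (1 - x)"
        using gc[of "Suc n"] by (simp add: h_def algebra_simps)
      \<comment> \<open>As L is at least every time up to the horizon, \<open>1 / L\<close> costs at
        most one more \<open>1 / Suc n\<close>; hence the \<open>a + 1\<close> in the
        constant.\<close>
      moreover have "a / real (Suc n) + 1 / L \<le> (a + 1) / real (Suc n)"
      proof -
        have "1 / L \<le> 1 / real (Suc n)"
          using Suc.prems L by (intro divide_left_mono) auto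
        then show ?thesis by (simp add: add_divide_distrib)
      qed
      moreover have "0 < a / real (Suc n) + 1 / L" using D L by (intro add_pos_pos) auto
      ultimately have "c / real (Suc n) / ((a + 1) / real (Suc n)) \<le> (x + h * (1 - x)) / (a / real (Suc n) + 1 / L)"
        using c win_in_unit[of h x] h Suc.prems(3) by (intro frac_le) auto
      then show ?thesis by (simp add: q_def)
    qed
    finally show ?thesis .
  qed
  have "bandit_trans pA pB \<gamma> (Suc d + e) n (\<lambda>x. exp (- L * x)) x
      = x * (pA * f (x + h * (1 - x)) + (1 - pA) * f x) + (1 - x) * (pB * f (x - h * x) + (1 - pB) * f x)"
    by (simp add: bandit_step_def f_def h_def)
  also have "\<dots> \<le> x * (pA * q + (1 - pA) * (q + W * (1 / (1 + x * v))))
      + (1 - x) * (pB * (q + W * (1 / (1 + (x - h * x) * v))) + (1 - pB) * (q + W * (1 / (1 + x * v))))"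
    using p x01 win IH[of x] IH[of "x - h * x"] loss_in_unit[of h x] h Suc.prems(3)
    by (intro add_mono mult_left_mono) auto
  \<comment> \<open>The coefficient of \<open>q\<close> is 1, since the four transition
    probabilities sum to 1; what remains is W times the operator killed at a win.\<close>
  also have "\<dots> = q + W * (x * (1 - pA) * (1 / (1 + x * v)) +
      (1 - x) * (pB * (1 / (1 + (x - h * x) * v)) + (1 - pB) * (1 / (1 + x * v))))"
    by (simp add: algebra_simps)
  also have "\<dots> \<le> q + W * ((1 + 4 * h\<^sup>2) * (1 / (1 + x * survival_weight pB \<gamma> (Suc d) n)))"
    using p h v W Suc.prems(3)
    by (intro add_left_mono mult_left_mono no_win_step) (auto simp: v_def h_def)
  also have "\<dots> = q + (\<Prod>j<Suc d. 1 + 4 * (\<gamma> (Suc (n + j)))\<^sup>2) / (1 + x * survival_weight pB \<gamma> (Suc d) n)"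
    by (simp only: prod.lessThan_Suc_shift) (simp add: W_def h_def)
  finally show ?case by (simp only: q_def)
qed

section \<open>Sums of squared steps and divergence of shifted products\<close>

lemma sum_inverse_squares_le:
  assumes "n \<ge> 1"
  shows "(\<Sum>j<e. 1 / (real (Suc (n + j)))\<^sup>2) \<le> 1 / real n - 1 / real (n + e)"
proof (induction e)
  case 0
  then show ?case by simp
next
  case (Suc e)
  have "1 / (real (Suc (n + e)))\<^sup>2 \<le> 1 / (real (n + e) * real (Suc (n + e)))"
    using assms by (intro divide_left_mono) (auto simp: power2_eq_square intro!: mult_pos_pos)
  also have "\<dots> = 1 / real (n + e) - 1 / real (n + Suc e)"
    using assms by (simp add: field_simps)
  finally show ?case using Suc by simp
qed

text \<open>The telescoped difference is kept because the convergence proof for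
  \<open>pA = pB\<close> needs it: between consecutive squares it is only of the order of an inverse
  cube.\<close>

lemma sum_gamma_squares_le:
  assumes g: "\<And>k. k \<ge> 1 \<Longrightarrow> 0 < \<gamma> k" and gD: "\<And>k. k \<ge> 1 \<Longrightarrow> \<gamma> k \<le> D / real k" and n: "n \<ge> 1"
  shows "(\<Sum>j<e. (\<gamma> (Suc (n + j)))\<^sup>2) \<le> D\<^sup>2 * (1 / real n - 1 / real (n + e))"
proof -
  have "(\<Sum>j<e. (\<gamma> (Suc (n + j)))\<^sup>2) \<le> (\<Sum>j<e. D\<^sup>2 * (1 / (real (Suc (n + j)))\<^sup>2))"
  proof (intro sum_mono)
    fix j
    have "(\<gamma> (Suc (n + j)))\<^sup>2 \<le> (D / real (Suc (n + j)))\<^sup>2"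
      using g[of "Suc (n + j)"] gD[of "Suc (n + j)"] by (intro power_mono) auto
    then show "(\<gamma> (Suc (n + j)))\<^sup>2 \<le> D\<^sup>2 * (1 / (real (Suc (n + j)))\<^sup>2)" by (simp add: power_divide)
  qed
  also have "\<dots> \<le> D\<^sup>2 * (1 / real n - 1 / real (n + e))"
    unfolding sum_distrib_left[symmetric] by (intro mult_left_mono sum_inverse_squares_le n) auto
  finally show ?thesis .
qed

lemma filterlim_partial_sums_at_top:
  fixes f :: "nat \<Rightarrow> real"
  assumes nn: "\<And>k. 0 \<le> f k" and ns: "\<not> summable f"
  shows "filterlim (\<lambda>d. \<Sum>k<d. f k) at_top at_top"
proof -
  have "\<exists>N. Z \<le> (\<Sum>k<N. f k)" for Z
  proof (rule ccontr)
    assume "\<nexists>N. Z \<le> (\<Sum>k<N. f k)"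
    then have "(\<Sum>k<N. f k) \<le> Z" for N by (auto simp: not_le intro: less_imp_le)
    then show False using ns nn by (auto intro: summableI_nonneg_bounded)
  qed
  moreover have "(\<Sum>k<N. f k) \<le> (\<Sum>k<n. f k)" if "N \<le> n" for N n
    using that nn by (intro sum_mono2) auto
  ultimately show ?thesis
    unfolding filterlim_at_top eventually_sequentially by (meson order_trans)
qed

lemma filterlim_shifted_products:
  fixes pB :: real
  assumes p: "0 \<le> pB" "pB \<le> 1" and g: "\<And>k. k \<ge> 1 \<Longrightarrow> 0 < \<gamma> k \<and> \<gamma> k < 1"
    and ns: "\<not> summable (\<lambda>k. \<Prod>j=1..k. 1 - pB * \<gamma> j)"
  shows "filterlim (\<lambda>d. \<Sum>k<d. \<Prod>j<k. 1 - pB * \<gamma> (Suc (n + j))) at_top at_top"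
proof -
  have pos: "0 < 1 - pB * \<gamma> k" if "k \<ge> 1" for k
    using shrink_factor_pos[of pB "\<gamma> k"] p g[OF that] by simp
  let ?f = "\<lambda>k. \<Prod>j<k. 1 - pB * \<gamma> (Suc (n + j))"
  let ?P = "\<Prod>j=1..n. 1 - pB * \<gamma> j"
  have eq: "(\<Prod>j=1..k+n. 1 - pB * \<gamma> j) = ?P * ?f k" for k
  proof (induction k)
    case (Suc k)
    then show ?case by (simp add: algebra_simps)
  qed simp
  have P: "?P > 0" using pos by (intro prod_pos) auto
  have "\<not> summable ?f"
  proof
    assume "summable ?f"
    then have "summable (\<lambda>k. ?P * ?f k)" by (rule summable_mult)
    then have "summable (\<lambda>k. \<Prod>j=1..k+n. 1 - pB * \<gamma> j)" unfolding eq .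
    then show False using ns summable_iff_shift[of "\<lambda>k. \<Prod>j=1..k. 1 - pB * \<gamma> j" n] by simp
  qed
  moreover have "0 \<le> ?f k" for k using pos by (intro prod_nonneg) (auto intro: less_imp_le)
  ultimately show ?thesis
    by (intro filterlim_partial_sums_at_top)
qed

section \<open>Independence of the past from the future environment\<close>

context bandit_environment
begin

lemma U_meas [measurable]: "n \<ge> 1 \<Longrightarrow> U n \<in> borel_measurable M"
  using U_indep by (auto simp: indep_vars_def)

lemma AB_meas [measurable]: "n \<ge> 1 \<Longrightarrow> indicator_pair A B n \<in> borel_measurable M"
  using AB_indep by (auto simp: indep_vars_def)

definition env_event ::
  "(nat \<Rightarrow> real set) \<Rightarrow> (nat \<Rightarrow> (real \<times> real) set) \<Rightarrow> nat set \<Rightarrow> 'a set" where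
  "env_event S T J = {\<omega> \<in> space M. \<forall>j\<in>J. U j \<omega> \<in> S j \<and> indicator_pair A B j \<omega> \<in> T j}"

lemma env_event_meas [measurable]:
  assumes "\<And>j. S j \<in> sets borel" "\<And>j. T j \<in> sets borel" "finite J" "J \<subseteq> {1..}"
  shows "env_event S T J \<in> events"
proof -
  have "{\<omega> \<in> space M. U j \<omega> \<in> S j \<and> indicator_pair A B j \<omega> \<in> T j} \<in> events" if "j \<in> J" for j
  proof -
    have [measurable]: "U j \<in> borel_measurable M" "indicator_pair A B j \<in> borel_measurable M"
      using assms(4) that by auto
    have [measurable]: "S j \<in> sets borel" "T j \<in> sets borel" using assms by auto
    show ?thesis by measurable
  qed
  then show ?thesis
    unfolding env_event_def using assms(3) by (intro sets.sets_Collect_finite_All) auto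
qed

lemma prob_env_event:
  assumes S: "\<And>j. S j \<in> sets borel" and T: "\<And>j. T j \<in> sets borel" and J: "finite J" "J \<subseteq> {1..}"
  shows "prob (env_event S T J) =
    (\<Prod>j\<in>J. prob (U j -` S j \<inter> space M) * prob (indicator_pair A B j -` T j \<inter> space M))"
proof (cases "J = {}")
  case True
  then show ?thesis by (simp add: env_event_def prob_space)
next
  case False
  let ?E = "{\<omega> \<in> space M. \<forall>j\<in>J. U j \<omega> \<in> S j}"
  let ?F = "{\<omega> \<in> space M. \<forall>j\<in>J. indicator_pair A B j \<omega> \<in> T j}"
  \<comment> \<open>Independence of the two sequences is available only for the sigma-algebras
    generated by the whole sequences, so cylinder events must be pulled back from the product space.
    The value type is left open to cover both sequences.\<close>
  have cyl: "{\<omega> \<in> space M. \<forall>j\<in>J. Z j \<omega> \<in> R j} \<in>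
      sets (vimage_algebra (space M) (\<lambda>\<omega>. \<lambda>n\<in>{1..}. Z n \<omega>) (\<Pi>\<^sub>M n\<in>{1..}. borel))"
    if R: "\<And>j. R j \<in> sets borel" for Z :: "nat \<Rightarrow> 'a \<Rightarrow> 'c::topological_space" and R
  proof -
    let ?C = "{f \<in> space (\<Pi>\<^sub>M n\<in>{1::nat..}. (borel::'c measure)). \<forall>j\<in>J. f j \<in> R j}"
    have "{f \<in> space (\<Pi>\<^sub>M n\<in>{1::nat..}. (borel::'c measure)). f j \<in> R j} \<in> sets (\<Pi>\<^sub>M n\<in>{1..}. borel)"
      if "j \<in> J" for j
    proof -
      have [measurable]: "R j \<in> sets borel" by (rule R)
      have [measurable]: "(\<lambda>f. f j) \<in> measurable (\<Pi>\<^sub>M n\<in>{1::nat..}. (borel::'c measure)) borel"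
        using J that by (intro measurable_component_singleton) auto
      show ?thesis by measurable
    qed
    then have C: "?C \<in> sets (\<Pi>\<^sub>M n\<in>{1..}. borel)"
      using J by (intro sets.sets_Collect_finite_All) auto
    have "{\<omega> \<in> space M. \<forall>j\<in>J. Z j \<omega> \<in> R j} = (\<lambda>\<omega>. \<lambda>n\<in>{1..}. Z n \<omega>) -` ?C \<inter> space M"
    proof (rule set_eqI)
      fix \<omega>
      have "(\<lambda>n\<in>{1..}. Z n \<omega>) \<in> space (\<Pi>\<^sub>M n\<in>{1::nat..}. (borel::'c measure))"
        by (simp add: space_PiM)
      moreover have "(\<forall>j\<in>J. (\<lambda>n\<in>{1..}. Z n \<omega>) j \<in> R j) \<longleftrightarrow> (\<forall>j\<in>J. Z j \<omega> \<in> R j)"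
        using J by (intro ball_cong) auto
      ultimately show "\<omega> \<in> {\<omega> \<in> space M. \<forall>j\<in>J. Z j \<omega> \<in> R j} \<longleftrightarrow>
          \<omega> \<in> (\<lambda>\<omega>. \<lambda>n\<in>{1..}. Z n \<omega>) -` ?C \<inter> space M"
        by auto
    qed
    then show ?thesis by (simp only: in_vimage_algebra[OF C])
  qed
  have "env_event S T J = ?E \<inter> ?F" by (auto simp: env_event_def)
  then have "prob (env_event S T J) = prob ?E * prob ?F"
    using indep_setD[OF U_AB_indep cyl[of S U] cyl[of T "indicator_pair A B"]] S T by simp
  also have "?E = (\<Inter>j\<in>J. U j -` S j \<inter> space M)" using False by auto
  also have "prob \<dots> = (\<Prod>j\<in>J. prob (U j -` S j \<inter> space M))"
    using S J False by (intro indep_varsD[OF U_indep]) auto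
  also have "?F = (\<Inter>j\<in>J. indicator_pair A B j -` T j \<inter> space M)" using False by auto
  also have "prob \<dots> = (\<Prod>j\<in>J. prob (indicator_pair A B j -` T j \<inter> space M))"
    using T J False by (intro indep_varsD[OF AB_indep]) auto
  finally show ?thesis by (simp add: prod.distrib)
qed

lemma prob_U_le: "n \<ge> 1 \<Longrightarrow> 0 \<le> w \<Longrightarrow> w \<le> 1 \<Longrightarrow> prob (U n -` {..w} \<inter> space M) = w"
proof -
  assume a: "n \<ge> 1" "0 \<le> w" "w \<le> 1"
  have "prob (U n -` {..w} \<inter> space M) = measure (distr M borel (U n)) {..w}"
    using a by (subst measure_distr) auto
  also have "\<dots> = measure (uniform_measure lborel {0..1}) {..w}"
    using a by (simp add: U_uniform)
  also have "\<dots> = measure lborel ({0..1} \<inter> {..w}) / measure lborel {0..1::real}"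
    by (intro measure_uniform_measure) auto
  also have "{0..1} \<inter> {..w} = {0..w}" using a by auto
  finally show ?thesis using a by simp
qed

lemma prob_U_gt: "n \<ge> 1 \<Longrightarrow> 0 \<le> w \<Longrightarrow> w \<le> 1 \<Longrightarrow> prob (U n -` {w<..} \<inter> space M) = 1 - w"
proof -
  assume a: "n \<ge> 1" "0 \<le> w" "w \<le> 1"
  have "U n -` {..w} \<inter> space M \<in> events" using a by (intro measurable_sets[of _ _ borel]) auto
  then have "prob (space M - U n -` {..w} \<inter> space M) = 1 - w"
    using prob_U_le[OF a] prob_compl by simp
  moreover have "space M - U n -` {..w} \<inter> space M = U n -` {w<..} \<inter> space M" by auto
  ultimately show ?thesis by simp
qed

lemma fst_snd_eq_one_sets [measurable]:
  "{p::real \<times> real. fst p = 1} \<in> sets borel" "{p::real \<times> real. fst p \<noteq> 1} \<in> sets borel"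
  "{p::real \<times> real. snd p = 1} \<in> sets borel" "{p::real \<times> real. snd p \<noteq> 1} \<in> sets borel"
proof -
  have [measurable]: "(fst :: real \<times> real \<Rightarrow> real) \<in> borel_measurable borel"
    "(snd :: real \<times> real \<Rightarrow> real) \<in> borel_measurable borel"
    by (auto simp: borel_prod[symmetric])
  have "{p\<in>space borel. fst p = (1::real)} \<in> sets (borel :: (real \<times> real) measure)"
    "{p\<in>space borel. fst p \<noteq> (1::real)} \<in> sets (borel :: (real \<times> real) measure)"
    "{p\<in>space borel. snd p = (1::real)} \<in> sets (borel :: (real \<times> real) measure)"
    "{p\<in>space borel. snd p \<noteq> (1::real)} \<in> sets (borel :: (real \<times> real) measure)"
    by measurable
  then show "{p::real \<times> real. fst p = 1} \<in> sets borel" "{p::real \<times> real. fst p \<noteq> 1} \<in> sets borel"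
    "{p::real \<times> real. snd p = 1} \<in> sets borel" "{p::real \<times> real. snd p \<noteq> 1} \<in> sets borel"
    by simp_all
qed

lemma prob_AB:
  assumes n: "n \<ge> 1"
  shows "prob (indicator_pair A B n -` {p. fst p = 1} \<inter> space M) = pA"
    and "prob (indicator_pair A B n -` {p. fst p \<noteq> 1} \<inter> space M) = 1 - pA"
    and "prob (indicator_pair A B n -` {p. snd p = 1} \<inter> space M) = pB"
    and "prob (indicator_pair A B n -` {p. snd p \<noteq> 1} \<inter> space M) = 1 - pB"
proof -
  have id: "prob (indicator_pair A B n -` T \<inter> space M) = prob (indicator_pair A B 1 -` T \<inter> space M)"
    if "T \<in> sets borel" for T
  proof -
    have "prob (indicator_pair A B n -` T \<inter> space M) = measure (distr M borel (indicator_pair A B n)) T"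
      using that n by (subst measure_distr) auto
    also have "\<dots> = measure (distr M borel (indicator_pair A B 1)) T"
      using AB_ident[OF n] by simp
    also have "\<dots> = prob (indicator_pair A B 1 -` T \<inter> space M)"
      using that by (subst measure_distr) auto
    finally show ?thesis .
  qed
  have eqA: "indicator_pair A B 1 -` {p. fst p = 1} \<inter> space M = A 1"
    "indicator_pair A B 1 -` {p. fst p \<noteq> 1} \<inter> space M = space M - A 1"
    "indicator_pair A B 1 -` {p. snd p = 1} \<inter> space M = B 1"
    "indicator_pair A B 1 -` {p. snd p \<noteq> 1} \<inter> space M = space M - B 1"
    using sets.sets_into_space[OF A_events[of 1]] sets.sets_into_space[OF B_events[of 1]]
    by (auto simp: indicator_pair_def indicator_def split: if_splits)
  show "prob (indicator_pair A B n -` {p. fst p = 1} \<inter> space M) = pA"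
    "prob (indicator_pair A B n -` {p. fst p \<noteq> 1} \<inter> space M) = 1 - pA"
    "prob (indicator_pair A B n -` {p. snd p = 1} \<inter> space M) = pB"
    "prob (indicator_pair A B n -` {p. snd p \<noteq> 1} \<inter> space M) = 1 - pB"
    unfolding id[OF fst_snd_eq_one_sets(1)] id[OF fst_snd_eq_one_sets(2)] id[OF fst_snd_eq_one_sets(3)]
      id[OF fst_snd_eq_one_sets(4)] eqA
    using prob_A prob_B A_events[of 1] B_events[of 1] by (simp_all add: prob_compl)
qed

text \<open>Plays the role of \<open>D \<in> \<F>\<^sub>n\<close>; only the independence from the future is ever used.\<close>

definition past :: "nat \<Rightarrow> 'a set \<Rightarrow> bool" where
  "past n D \<longleftrightarrow> D \<in> events \<and> (\<forall>S T m. (\<forall>j. S j \<in> sets borel) \<longrightarrow> (\<forall>j. T j \<in> sets borel) \<longrightarrow>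
     prob (D \<inter> env_event S T {n<..m}) = prob D * prob (env_event S T {n<..m}))"

lemma pastD:
  assumes "past n D" "\<And>j. S j \<in> sets borel" "\<And>j. T j \<in> sets borel"
  shows "prob (D \<inter> env_event S T {n<..m}) = prob D * prob (env_event S T {n<..m})"
  using assms by (auto simp: past_def)

lemma past_events: "past n D \<Longrightarrow> D \<in> events"
  by (simp add: past_def)

lemma past_space: "past n (space M)"
proof -
  have "space M \<inter> env_event S T J = env_event S T J" for S T J by (auto simp: env_event_def)
  then show ?thesis by (auto simp: past_def prob_space)
qed

text \<open>A condition on the environment at time \<open>Suc n\<close> can be read as one more
  coordinate of a future event seen from time n. Independence of \<open>D\<close> from that enlarged
  event yields both claims.\<close>

lemma past_Suc:
  assumes D: "past n D" and S: "S \<in> sets borel" and T: "T \<in> sets borel"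
  defines "D' \<equiv> D \<inter> (U (Suc n) -` S \<inter> space M) \<inter> (indicator_pair A B (Suc n) -` T \<inter> space M)"
  shows "past (Suc n) D'"
    and "prob D' = prob D * (prob (U (Suc n) -` S \<inter> space M) * prob (indicator_pair A B (Suc n) -` T \<inter> space M))"
proof -
  have key: "prob (D' \<inter> env_event S' T' {Suc n<..m}) =
     prob D * (prob (U (Suc n) -` S \<inter> space M) * prob (indicator_pair A B (Suc n) -` T \<inter> space M))
       * prob (env_event S' T' {Suc n<..m})"
    if ST: "\<And>j. S' j \<in> sets borel" "\<And>j. T' j \<in> sets borel" and m: "m \<ge> Suc n" for S' T' m
  proof -
    let ?S = "\<lambda>j. if j = Suc n then S else S' j" and ?T = "\<lambda>j. if j = Suc n then T else T' j"
    have ins: "{n<..m} = insert (Suc n) {Suc n<..m}" using m by auto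
    have "D' \<inter> env_event S' T' {Suc n<..m} = D \<inter> env_event ?S ?T {n<..m}"
      unfolding ins D'_def env_event_def by auto
    also have "prob \<dots> = prob D * prob (env_event ?S ?T {n<..m})"
      using ST S T by (intro pastD[OF D]) auto
    also have "prob (env_event ?S ?T {n<..m}) =
       prob (U (Suc n) -` S \<inter> space M) * prob (indicator_pair A B (Suc n) -` T \<inter> space M)
         * (\<Prod>j\<in>{Suc n<..m}. prob (U j -` ?S j \<inter> space M) * prob (indicator_pair A B j -` ?T j \<inter> space M))"
      using ST S T by (subst prob_env_event) (auto simp: ins)
    also have "(\<Prod>j\<in>{Suc n<..m}. prob (U j -` ?S j \<inter> space M) * prob (indicator_pair A B j -` ?T j \<inter> space M))
       = prob (env_event S' T' {Suc n<..m})"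
      using ST by (subst prob_env_event) (auto intro!: prod.cong)
    finally show ?thesis by simp
  qed
  have D'e: "D' \<in> events"
    unfolding D'_def using past_events[OF D] S T by (intro sets.Int measurable_sets[of _ M borel]) auto
  have e0: "env_event S' T' {} = space M" for S' :: "nat \<Rightarrow> real set" and T' :: "nat \<Rightarrow> (real \<times> real) set" by (auto simp: env_event_def)
  \<comment> \<open>With an empty range of future times, \<open>key\<close> becomes the formula for
    the probability of \<open>D'\<close> itself.\<close>
  have "prob (D' \<inter> env_event (\<lambda>_. UNIV) (\<lambda>_. UNIV) {Suc n<..Suc n}) = prob D'"
    using sets.sets_into_space[OF D'e] by (simp add: e0 Int_absorb2)
  with key[of "\<lambda>_. UNIV" "\<lambda>_. UNIV" "Suc n"]
  show p: "prob D' = prob D * (prob (U (Suc n) -` S \<inter> space M) * prob (indicator_pair A B (Suc n) -` T \<inter> space M))"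
    by (simp add: e0 prob_space)
  show "past (Suc n) D'"
    unfolding past_def
  proof (intro conjI allI impI)
    fix S' :: "nat \<Rightarrow> real set" and T' :: "nat \<Rightarrow> (real \<times> real) set" and m :: nat
    assume ST: "\<forall>j. S' j \<in> sets borel" "\<forall>j. T' j \<in> sets borel"
    show "prob (D' \<inter> env_event S' T' {Suc n<..m}) = prob D' * prob (env_event S' T' {Suc n<..m})"
    proof (cases "m \<ge> Suc n")
      case True
      with key[of S' T' m] ST p show ?thesis by simp
    next
      case False
      then have "{Suc n<..m} = {}" by auto
      then show ?thesis using sets.sets_into_space[OF D'e] by (simp add: e0 prob_space Int_absorb2)
    qed
  qed (rule D'e)
qed

end

section \<open>The bandit process\<close>

text \<open>The counterpart of \<open>bandit_trans\<close> for the chain killed as soon as arm A is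
  tried, whether or not the trial wins.\<close>

primrec bandit_surv ::
  "real \<Rightarrow> (nat \<Rightarrow> real) \<Rightarrow> nat \<Rightarrow> nat \<Rightarrow> (real \<Rightarrow> real) \<Rightarrow> real \<Rightarrow> real" where
  "bandit_surv pB \<gamma> 0 n f x = f x"
| "bandit_surv pB \<gamma> (Suc d) n f x = (1 - x) *
     (pB * bandit_surv pB \<gamma> d (Suc n) f (x - \<gamma> (Suc n) * x) + (1 - pB) * bandit_surv pB \<gamma> d (Suc n) f x)"

lemma AE_summable_of_summable_integral:
  fixes g :: "nat \<Rightarrow> 'a \<Rightarrow> real"
  assumes int: "\<And>i. integrable M (g i)" and nn: "\<And>i \<omega>. 0 \<le> g i \<omega>"
    and sum: "summable (\<lambda>i. \<integral>\<omega>. g i \<omega> \<partial>M)"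
  shows "AE \<omega> in M. summable (\<lambda>i. g i \<omega>)"
proof -
  have [measurable]: "g i \<in> borel_measurable M" for i using int by auto
  have "(\<integral>\<^sup>+\<omega>. (\<Sum>i. ennreal (g i \<omega>)) \<partial>M) = (\<Sum>i. \<integral>\<^sup>+\<omega>. ennreal (g i \<omega>) \<partial>M)"
    by (intro nn_integral_suminf) auto
  also have "\<dots> = (\<Sum>i. ennreal (\<integral>\<omega>. g i \<omega> \<partial>M))"
    using int nn by (intro suminf_cong nn_integral_eq_integral) auto
  also have "\<dots> = ennreal (\<Sum>i. \<integral>\<omega>. g i \<omega> \<partial>M)"
    using sum nn by (intro suminf_ennreal2) auto
  finally have "(\<integral>\<^sup>+\<omega>. (\<Sum>i. ennreal (g i \<omega>)) \<partial>M) \<noteq> \<infinity>" by simp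
  then have "AE \<omega> in M. (\<Sum>i. ennreal (g i \<omega>)) \<noteq> \<infinity>"
    by (intro nn_integral_PInf_AE) auto
  then show ?thesis
    by eventually_elim (use nn in \<open>auto intro!: summable_suminf_not_top\<close>)
qed

locale bandit_process = bandit_environment M U A B pA pB
  for M :: "'a measure" and U A B pA pB +
  fixes \<gamma> :: "nat \<Rightarrow> real" and x0 :: real
  assumes gamma: "\<And>k. k \<ge> 1 \<Longrightarrow> 0 < \<gamma> k \<and> \<gamma> k < 1"
    and x0: "x0 \<in> {0<..1}"
begin

lemma pA01: "0 \<le> pA" "pA \<le> 1" and pB01: "0 \<le> pB" "pB \<le> 1"
  using prob_A prob_B by auto

abbreviation X :: "nat \<Rightarrow> 'a \<Rightarrow> real" where "X \<equiv> bandit \<gamma> U A B x0"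

lemma X_Suc: "X (Suc n) \<omega> =
   (if U (Suc n) \<omega> \<le> X n \<omega>
    then (if \<omega> \<in> A (Suc n) then X n \<omega> + \<gamma> (Suc n) * (1 - X n \<omega>) else X n \<omega>)
    else (if \<omega> \<in> B (Suc n) then X n \<omega> - \<gamma> (Suc n) * X n \<omega> else X n \<omega>))"
  by (auto simp: Let_def indicator_def)

declare bandit.simps(2) [simp del]

lemma X_in: "X n \<omega> \<in> {0<..1}"
proof (induction n)
  case 0
  then show ?case using x0 by simp
next
  case (Suc n)
  then show ?case
    using win_in_unit[of "\<gamma> (Suc n)" "X n \<omega>"] loss_in_unit[of "\<gamma> (Suc n)" "X n \<omega>"] gamma[of "Suc n"]
    unfolding X_Suc by simp
qed

lemma X_bounds: "0 < X n \<omega>" "X n \<omega> \<le> 1"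
  using X_in[of n \<omega>] by auto

lemma X_meas [measurable]: "X n \<in> borel_measurable M"
proof (induction n)
  case 0
  then show ?case by simp
next
  case (Suc n)
  note [measurable] = Suc
  have [measurable]: "U (Suc n) \<in> borel_measurable M" "A (Suc n) \<in> events" "B (Suc n) \<in> events"
    using A_events B_events by auto
  show ?case unfolding X_Suc by measurable
qed

text \<open>At worst every step is a loss, so there is a deterministic lower bound. It allows a
  horizon to be chosen uniformly over all outcomes.\<close>

lemma X_lower: "\<exists>\<delta>>0. \<forall>\<omega>. \<delta> \<le> X n \<omega>"
proof (induction n)
  case 0
  then show ?case using x0 by auto
next
  case (Suc n)
  then obtain \<delta> where \<delta>: "\<delta> > 0" "\<And>\<omega>. \<delta> \<le> X n \<omega>" by auto
  have g: "0 < \<gamma> (Suc n)" "\<gamma> (Suc n) < 1" using gamma[of "Suc n"] by auto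
  show ?case
  proof (intro exI[of _ "\<delta> * (1 - \<gamma> (Suc n))"] conjI allI)
    fix \<omega>
    have "\<delta> * (1 - \<gamma> (Suc n)) \<le> X n \<omega> * (1 - \<gamma> (Suc n))"
      using \<delta> g by (intro mult_right_mono) auto
    also have "\<dots> \<le> X (Suc n) \<omega>"
      using g X_bounds[of n \<omega>] by (auto simp: X_Suc algebra_simps intro: add_increasing)
    finally show "\<delta> * (1 - \<gamma> (Suc n)) \<le> X (Suc n) \<omega>" .
  qed (use \<delta> g in auto)
qed

text \<open>The Markov property in elementary form. On \<open>D\<close> the state is constant, so
  trying A or B and succeeding or failing cut \<open>D\<close> into four events, each with constant
  next state and product probability. Separate \<open>c\<close> and \<open>c'\<close> distinguish
  trials of A from trials of B, so that the same lemma also serves the killed chain.\<close>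

lemma integral_split:
  assumes D: "past n D" "\<And>\<omega>. \<omega> \<in> D \<Longrightarrow> X n \<omega> = w" and w: "w \<in> {0<..1}"
    and H: "\<And>D' z. past (Suc n) D' \<Longrightarrow> (\<And>\<omega>. \<omega> \<in> D' \<Longrightarrow> X n \<omega> = w \<and> U (Suc n) \<omega> \<le> w \<and> X (Suc n) \<omega> = z) \<Longrightarrow>
       z \<in> {0<..1} \<Longrightarrow> has_bochner_integral M (\<lambda>\<omega>. indicator D' \<omega> * \<Phi> \<omega>) (prob D' * c z)"
    and H': "\<And>D' z. past (Suc n) D' \<Longrightarrow> (\<And>\<omega>. \<omega> \<in> D' \<Longrightarrow> X n \<omega> = w \<and> U (Suc n) \<omega> > w \<and> X (Suc n) \<omega> = z) \<Longrightarrow>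
       z \<in> {0<..1} \<Longrightarrow> has_bochner_integral M (\<lambda>\<omega>. indicator D' \<omega> * \<Phi> \<omega>) (prob D' * c' z)"
  shows "has_bochner_integral M (\<lambda>\<omega>. indicator D \<omega> * \<Phi> \<omega>)
    (prob D * (w * (pA * c (w + \<gamma> (Suc n) * (1 - w)) + (1 - pA) * c w)
      + (1 - w) * (pB * c' (w - \<gamma> (Suc n) * w) + (1 - pB) * c' w)))"
proof -
  define atm where "atm S T = D \<inter> (U (Suc n) -` S \<inter> space M) \<inter> (indicator_pair A B (Suc n) -` T \<inter> space M)" for S T
  let ?U1 = "{..w}" and ?U2 = "{w<..}"
  let ?A1 = "{p::real\<times>real. fst p = 1}" and ?A2 = "{p::real\<times>real. fst p \<noteq> 1}"
  let ?B1 = "{p::real\<times>real. snd p = 1}" and ?B2 = "{p::real\<times>real. snd p \<noteq> 1}"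
  have g: "0 < \<gamma> (Suc n)" "\<gamma> (Suc n) < 1" using gamma[of "Suc n"] by auto
  have past: "past (Suc n) (atm S T)" if "S \<in> sets borel" "T \<in> sets borel" for S T
    unfolding atm_def using past_Suc(1)[OF D(1) that] .
  have pr: "prob (atm ?U1 ?A1) = prob D * (w * pA)" "prob (atm ?U1 ?A2) = prob D * (w * (1 - pA))"
    "prob (atm ?U2 ?B1) = prob D * ((1 - w) * pB)" "prob (atm ?U2 ?B2) = prob D * ((1 - w) * (1 - pB))"
    unfolding atm_def using w
    by (subst past_Suc(2)[OF D(1)]; (subst prob_AB)?; simp add: prob_U_le prob_U_gt fst_snd_eq_one_sets prob_AB)+
  have ABn: "\<omega> \<in> A (Suc n) \<longleftrightarrow> fst (indicator_pair A B (Suc n) \<omega>) = 1"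
    "\<omega> \<in> B (Suc n) \<longleftrightarrow> snd (indicator_pair A B (Suc n) \<omega>) = 1" for \<omega>
    by (auto simp: indicator_pair_def indicator_def)
  have 1: "has_bochner_integral M (\<lambda>\<omega>. indicator (atm ?U1 ?A1) \<omega> * \<Phi> \<omega>) (prob (atm ?U1 ?A1) * c (w + \<gamma> (Suc n) * (1 - w)))"
    by (intro H past win_in_unit g w) (auto simp: atm_def X_Suc ABn D(2) fst_snd_eq_one_sets)
  have 2: "has_bochner_integral M (\<lambda>\<omega>. indicator (atm ?U1 ?A2) \<omega> * \<Phi> \<omega>) (prob (atm ?U1 ?A2) * c w)"
    by (intro H past w) (auto simp: atm_def X_Suc ABn D(2) fst_snd_eq_one_sets)
  have 3: "has_bochner_integral M (\<lambda>\<omega>. indicator (atm ?U2 ?B1) \<omega> * \<Phi> \<omega>) (prob (atm ?U2 ?B1) * c' (w - \<gamma> (Suc n) * w))"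
    by (intro H' past loss_in_unit g w) (auto simp: atm_def X_Suc ABn D(2) fst_snd_eq_one_sets)
  have 4: "has_bochner_integral M (\<lambda>\<omega>. indicator (atm ?U2 ?B2) \<omega> * \<Phi> \<omega>) (prob (atm ?U2 ?B2) * c' w)"
    by (intro H' past w) (auto simp: atm_def X_Suc ABn D(2) fst_snd_eq_one_sets)
  note sum = has_bochner_integral_add[OF has_bochner_integral_add[OF 1 2] has_bochner_integral_add[OF 3 4]]
  have "D \<subseteq> space M" using sets.sets_into_space[OF past_events[OF D(1)]] .
  then have "(\<lambda>\<omega>. (indicator (atm ?U1 ?A1) \<omega> * \<Phi> \<omega> + indicator (atm ?U1 ?A2) \<omega> * \<Phi> \<omega>) +
     (indicator (atm ?U2 ?B1) \<omega> * \<Phi> \<omega> + indicator (atm ?U2 ?B2) \<omega> * \<Phi> \<omega>)) = (\<lambda>\<omega>. indicator D \<omega> * \<Phi> \<omega>)"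
    by (auto simp: atm_def indicator_def fun_eq_iff)
  with sum show ?thesis by (simp add: pr algebra_simps)
qed

lemma integral_const:
  assumes "past n D" "\<And>\<omega>. \<omega> \<in> D \<Longrightarrow> \<Phi> \<omega> = (c::real)"
  shows "has_bochner_integral M (\<lambda>\<omega>. indicator D \<omega> * \<Phi> \<omega>) (prob D * c)"
proof -
  have "has_bochner_integral M (\<lambda>\<omega>. indicator D \<omega> * c) (prob D * c)"
    using past_events[OF assms(1)]
    by (intro has_bochner_integral_mult_left has_bochner_integral_real_indicator) (auto simp: emeasure_eq_measure)
  also have "(\<lambda>\<omega>. indicator D \<omega> * c) = (\<lambda>\<omega>. indicator D \<omega> * \<Phi> \<omega>)"
    using assms(2) by (auto simp: indicator_def fun_eq_iff)
  finally show ?thesis .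
qed

lemma integral_one_time:
  assumes "past n D" "\<And>\<omega>. \<omega> \<in> D \<Longrightarrow> X n \<omega> = w" "w \<in> {0<..1}"
  shows "has_bochner_integral M (\<lambda>\<omega>. indicator D \<omega> * f (X (n + e) \<omega>)) (prob D * bandit_trans pA pB \<gamma> e n f w)"
  using assms
proof (induction e arbitrary: n D w)
  case 0
  then show ?case by (auto intro!: integral_const)
next
  case (Suc e)
  have "has_bochner_integral M (\<lambda>\<omega>. indicator D' \<omega> * f (X (n + Suc e) \<omega>))
      (prob D' * bandit_trans pA pB \<gamma> e (Suc n) f z)"
    if "past (Suc n) D'" "\<And>\<omega>. \<omega> \<in> D' \<Longrightarrow> X (Suc n) \<omega> = z" "z \<in> {0<..1}" for D' z
    using Suc.IH[OF that] by simp
  then show ?case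
    unfolding bandit_trans.simps bandit_step_def by (intro integral_split[OF Suc.prems]) auto
qed

lemma integral_two_times:
  assumes "past n D" "\<And>\<omega>. \<omega> \<in> D \<Longrightarrow> X n \<omega> = w" "w \<in> {0<..1}"
  shows "has_bochner_integral M (\<lambda>\<omega>. indicator D \<omega> * F (X (n + d) \<omega>) (X (n + d + e) \<omega>))
    (prob D * bandit_trans pA pB \<gamma> d n (\<lambda>y. bandit_trans pA pB \<gamma> e (n + d) (F y) y) w)"
  using assms
proof (induction d arbitrary: n D w)
  case 0
  have "(\<lambda>\<omega>. indicator D \<omega> * F (X n \<omega>) (X (n + e) \<omega>)) = (\<lambda>\<omega>. indicator D \<omega> * F w (X (n + e) \<omega>))"
    using 0 by (auto simp: indicator_def fun_eq_iff)
  then show ?case using integral_one_time[OF 0, of "F w" e] by simp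
next
  case (Suc d)
  have "has_bochner_integral M (\<lambda>\<omega>. indicator D' \<omega> * F (X (n + Suc d) \<omega>) (X (n + Suc d + e) \<omega>))
      (prob D' * bandit_trans pA pB \<gamma> d (Suc n) (\<lambda>y. bandit_trans pA pB \<gamma> e (n + Suc d) (F y) y) z)"
    if "past (Suc n) D'" "\<And>\<omega>. \<omega> \<in> D' \<Longrightarrow> X (Suc n) \<omega> = z" "z \<in> {0<..1}" for D' z
    using Suc.IH[OF that] by simp
  then show ?case
    unfolding bandit_trans.simps(2)[of _ _ _ d] bandit_step_def by (intro integral_split[OF Suc.prems]) auto
qed

lemma integral_two_times_start:
  "has_bochner_integral M (\<lambda>\<omega>. F (X n \<omega>) (X (n + e) \<omega>))
    (bandit_trans pA pB \<gamma> n 0 (\<lambda>y. bandit_trans pA pB \<gamma> e n (F y) y) x0)"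
proof -
  have "has_bochner_integral M (\<lambda>\<omega>. indicator (space M) \<omega> * F (X n \<omega>) (X (n + e) \<omega>))
    (bandit_trans pA pB \<gamma> n 0 (\<lambda>y. bandit_trans pA pB \<gamma> e n (F y) y) x0)"
    using integral_two_times[OF past_space[of 0], of x0 F n e] x0 by (simp add: prob_space)
  then show ?thesis
    by (subst (asm) has_bochner_integral_cong[OF refl _ refl]) auto
qed

text \<open>True for arbitrary \<open>F\<close>, because each \<open>X n\<close> takes only finitely
  many values.\<close>

lemma integrable_two_times: "integrable M (\<lambda>\<omega>. F (X n \<omega>) (X (n + e) \<omega>) :: real)"
  using integral_two_times_start by (rule integrable.intros)

lemma integrable_one_time: "integrable M (\<lambda>\<omega>. f (X n \<omega>) :: real)"
  using integrable_two_times[of "\<lambda>y _. f y" n 0] by simp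

text \<open>Both sides equal the same iterated operator evaluated at \<open>x0\<close>; for the
  right side this is the case of a second time lag 0.\<close>

lemma integral_tower:
  "(\<integral>\<omega>. F (X n \<omega>) (X (n + e) \<omega>) \<partial>M) = (\<integral>\<omega>. bandit_trans pA pB \<gamma> e n (F (X n \<omega>)) (X n \<omega>) \<partial>M)"
proof -
  have "(\<integral>\<omega>. F (X n \<omega>) (X (n + e) \<omega>) \<partial>M) =
      bandit_trans pA pB \<gamma> n 0 (\<lambda>y. bandit_trans pA pB \<gamma> e n (F y) y) x0"
    by (rule has_bochner_integral_integral_eq[OF integral_two_times_start])
  also have "\<dots> = (\<integral>\<omega>. bandit_trans pA pB \<gamma> e n (F (X n \<omega>)) (X n \<omega>) \<partial>M)"
    using has_bochner_integral_integral_eq[OF integral_two_times_start[of "\<lambda>y _. bandit_trans pA pB \<gamma> e n (F y) y" n 0]]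
    by simp
  finally show ?thesis .
qed

section \<open>Paths on which arm A is not tried\<close>

definition no_try :: "nat \<Rightarrow> nat \<Rightarrow> 'a set" where
  "no_try n d = {\<omega>\<in>space M. \<forall>k<d. X (n + k) \<omega> < U (Suc (n + k)) \<omega>}"

lemma no_try_meas [measurable]: "no_try n d \<in> events"
proof -
  have [measurable]: "U (Suc k) \<in> borel_measurable M" for k by auto
  show ?thesis unfolding no_try_def by measurable
qed

lemma integral_no_try:
  assumes "past n D" "\<And>\<omega>. \<omega> \<in> D \<Longrightarrow> X n \<omega> = w" "w \<in> {0<..1}"
  shows "has_bochner_integral M (\<lambda>\<omega>. indicator D \<omega> * (indicator (no_try n d) \<omega> * f (X (n + d) \<omega>)))
    (prob D * bandit_surv pB \<gamma> d n f w)"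
  using assms
proof (induction d arbitrary: n D w)
  case 0
  have "\<omega> \<in> D \<Longrightarrow> \<omega> \<in> space M" for \<omega>
    using sets.sets_into_space[OF past_events[OF 0(1)]] by auto
  then show ?case using 0 by (auto intro!: integral_const simp: no_try_def)
next
  case (Suc d)
  let ?\<Phi> = "\<lambda>\<omega>. indicator (no_try n (Suc d)) \<omega> * f (X (n + Suc d) \<omega>)"
  have all: "(\<forall>k<Suc d. P k) \<longleftrightarrow> P 0 \<and> (\<forall>k<d. P (Suc k))" for P
    by (auto simp: less_Suc_eq_0_disj)
  have *: "has_bochner_integral M (\<lambda>\<omega>. indicator D' \<omega> * ?\<Phi> \<omega>) (prob D' * 0)"
    if "past (Suc n) D'" "\<And>\<omega>. \<omega> \<in> D' \<Longrightarrow> X n \<omega> = w \<and> U (Suc n) \<omega> \<le> w \<and> X (Suc n) \<omega> = z" "z \<in> {0<..1}" for D' z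
  proof (rule integral_const[OF that(1)])
    fix \<omega> assume "\<omega> \<in> D'"
    from that(2)[OF this] show "?\<Phi> \<omega> = 0" by (simp add: no_try_def all)
  qed
  have **: "has_bochner_integral M (\<lambda>\<omega>. indicator D' \<omega> * ?\<Phi> \<omega>) (prob D' * bandit_surv pB \<gamma> d (Suc n) f z)"
    if D': "past (Suc n) D'" "\<And>\<omega>. \<omega> \<in> D' \<Longrightarrow> X n \<omega> = w \<and> U (Suc n) \<omega> > w \<and> X (Suc n) \<omega> = z" "z \<in> {0<..1}" for D' z
  proof -
    have "(\<lambda>\<omega>. indicator D' \<omega> * ?\<Phi> \<omega>) =
       (\<lambda>\<omega>. indicator D' \<omega> * (indicator (no_try (Suc n) d) \<omega> * f (X (Suc n + d) \<omega>)))"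
      using D'(2) by (auto simp: no_try_def all indicator_def fun_eq_iff)
    then show ?thesis using Suc.IH[OF D'(1) _ D'(3)] D'(2) by simp
  qed
  have "has_bochner_integral M (\<lambda>\<omega>. indicator D \<omega> * ?\<Phi> \<omega>)
    (prob D * (w * (pA * 0 + (1 - pA) * 0) + (1 - w) *
      (pB * bandit_surv pB \<gamma> d (Suc n) f (w - \<gamma> (Suc n) * w) + (1 - pB) * bandit_surv pB \<gamma> d (Suc n) f w)))"
    \<comment> \<open>Trying A at the first step kills the path, so that branch contributes 0; the
      branch of B continues by induction.\<close>
    by (rule integral_split[where c = "\<lambda>_. 0"]) (fact Suc.prems * **)+
  then show ?case by simp
qed

lemma integral_no_try_start:
  "has_bochner_integral M (\<lambda>\<omega>. indicator (no_try 0 d) \<omega> * f (X d \<omega>)) (bandit_surv pB \<gamma> d 0 f x0)"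
proof -
  have "has_bochner_integral M (\<lambda>\<omega>. indicator (space M) \<omega> * (indicator (no_try 0 d) \<omega> * f (X d \<omega>)))
    (bandit_surv pB \<gamma> d 0 f x0)"
    using integral_no_try[OF past_space[of 0], of x0 d f] x0 by (simp add: prob_space)
  then show ?thesis
    by (subst (asm) has_bochner_integral_cong[OF refl _ refl]) auto
qed

end

section \<open>Almost sure convergence\<close>

lemma AE_convergent_of_summable_increments:
  fixes Y :: "nat \<Rightarrow> 'a \<Rightarrow> real"
  assumes "\<And>i. integrable M (\<lambda>\<omega>. \<bar>Y (Suc i) \<omega> - Y i \<omega>\<bar>)"
    and "summable (\<lambda>i. \<integral>\<omega>. \<bar>Y (Suc i) \<omega> - Y i \<omega>\<bar> \<partial>M)"
  shows "AE \<omega> in M. convergent (\<lambda>i. Y i \<omega>)"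
proof -
  have "AE \<omega> in M. summable (\<lambda>i. \<bar>Y (Suc i) \<omega> - Y i \<omega>\<bar>)"
    using assms by (intro AE_summable_of_summable_integral) auto
  then show ?thesis
  proof eventually_elim
    case (elim \<omega>)
    then have "summable (\<lambda>i. Y (Suc i) \<omega> - Y i \<omega>)" by (rule summable_rabs_cancel)
    then have "convergent (\<lambda>n. \<Sum>i<n. Y (Suc i) \<omega> - Y i \<omega>)"
      by (simp add: summable_iff_convergent)
    then have "convergent (\<lambda>n. (Y n \<omega> - Y 0 \<omega>) + Y 0 \<omega>)"
      unfolding sum_lessThan_telescope[of "\<lambda>i. Y i \<omega>"] by (intro convergent_add convergent_const)
    then show ?case by simp
  qed
qed

text \<open>With equal success probabilities the process is a martingale, so the mixed term
  disappears and each step adds only its variance \<open>p * h^2 * x * (1 - x)\<close>.\<close>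

lemma bandit_trans_square:
  assumes p: "0 \<le> p" "p \<le> 1" and g: "\<And>k. k \<ge> 1 \<Longrightarrow> 0 < \<gamma> k \<and> \<gamma> k < 1" and y: "y \<in> {0<..1}"
  shows "bandit_trans p p \<gamma> e n (\<lambda>z. (z - a)\<^sup>2) y \<le> (y - a)\<^sup>2 + (\<Sum>j=n..<n+e. (\<gamma> (Suc j))\<^sup>2)"
proof (rule bandit_trans_supersolution[where \<phi> = "\<lambda>k y. (y - a)\<^sup>2 + (\<Sum>j=k..<n+e. (\<gamma> (Suc j))\<^sup>2)"])
  fix k and x :: real assume k: "n \<le> k" "k < n + e" and x: "x \<in> {0<..1}"
  define K where "K = (\<Sum>j=Suc k..<n+e. (\<gamma> (Suc j))\<^sup>2)"
  define h where "h = \<gamma> (Suc k)"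
  have "bandit_step p p h (\<lambda>x. (x - a)\<^sup>2 + K) x = (x - a)\<^sup>2 + K + h\<^sup>2 * (p * (x * (1 - x)))"
    by (simp add: bandit_step_def algebra_simps power2_eq_square)
  also have "h\<^sup>2 * (p * (x * (1 - x))) \<le> h\<^sup>2"
    using p x by (intro mult_left_le mult_le_one mult_nonneg_nonneg) auto
  finally show "bandit_step p p (\<gamma> (Suc k)) (\<lambda>y. (y - a)\<^sup>2 + (\<Sum>j=Suc k..<n+e. (\<gamma> (Suc j))\<^sup>2)) x
      \<le> (x - a)\<^sup>2 + (\<Sum>j=k..<n+e. (\<gamma> (Suc j))\<^sup>2)"
    using k by (simp add: K_def h_def sum.atLeast_Suc_lessThan)
qed (use p g y in auto)

context bandit_process
begin

lemma expectation_step: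
  "expectation (\<lambda>\<omega>. F (X n \<omega>) (X (Suc n) \<omega>))
    = expectation (\<lambda>\<omega>. bandit_step pA pB (\<gamma> (Suc n)) (F (X n \<omega>)) (X n \<omega>))"
  using integral_tower[of F n 1] by simp

text \<open>The mean of \<open>X n\<close> starts at \<open>x0\<close>, grows at each step by
  \<open>pA - pB\<close> times the summand, and never exceeds 1.\<close>

lemma summable_drift:
  assumes "pB < pA"
  shows "summable (\<lambda>n. expectation (\<lambda>\<omega>. \<gamma> (Suc n) * (X n \<omega> * (1 - X n \<omega>))))"
proof -
  let ?d = "\<lambda>n. expectation (\<lambda>\<omega>. \<gamma> (Suc n) * (X n \<omega> * (1 - X n \<omega>)))"
  have step: "expectation (X (Suc n)) = expectation (X n) + (pA - pB) * ?d n" for n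
  proof -
    have "expectation (X (Suc n)) = expectation (\<lambda>\<omega>. X n \<omega> + (pA - pB) * (\<gamma> (Suc n) * (X n \<omega> * (1 - X n \<omega>))))"
      using expectation_step[of "\<lambda>_ z. z" n] by (simp add: bandit_step_def algebra_simps)
    also have "\<dots> = expectation (X n) + (pA - pB) * ?d n"
      using integrable_one_time[of "\<lambda>x. x" n] integrable_one_time[of "\<lambda>x. (pA - pB) * (\<gamma> (Suc n) * (x * (1 - x)))" n]
      by (subst Bochner_Integration.integral_add) (auto simp: integral_mult_right_zero)
    finally show ?thesis .
  qed
  have sum: "expectation (X n) = x0 + (pA - pB) * (\<Sum>k<n. ?d k)" for n
    by (induction n) (simp_all add: step prob_space algebra_simps)
  have "(\<Sum>k<n. ?d k) \<le> 1 / (pA - pB)" for n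
  proof -
    have "expectation (X n) \<le> 1"
      using integrable_one_time[of "\<lambda>x. x" n] X_bounds by (intro integral_le_const) auto
    then have "(pA - pB) * (\<Sum>k<n. ?d k) \<le> 1" using sum[of n] x0 by simp
    then show ?thesis using assms by (simp add: pos_le_divide_eq mult.commute)
  qed
  moreover have "0 \<le> ?d n" for n
    using gamma[of "Suc n"] X_bounds by (intro Bochner_Integration.integral_nonneg mult_nonneg_nonneg) (auto simp: less_imp_le)
  ultimately show ?thesis by (intro summableI_nonneg_bounded)
qed

text \<open>The mean absolute increment is \<open>(pA + pB)\<close> times the same quantity whose
  multiple by \<open>pA - pB\<close> is the drift. Summability of the drift therefore makes the
  total variation of almost every path finite.\<close>

lemma AE_convergent_biased:
  assumes "pB < pA"
  shows "AE \<omega> in M. convergent (\<lambda>n. X n \<omega>)"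
proof (rule AE_convergent_of_summable_increments)
  fix i
  show "integrable M (\<lambda>\<omega>. \<bar>X (Suc i) \<omega> - X i \<omega>\<bar>)"
    using integrable_two_times[of "\<lambda>y z. \<bar>z - y\<bar>" i 1] by simp
next
  have "expectation (\<lambda>\<omega>. \<bar>X (Suc n) \<omega> - X n \<omega>\<bar>)
      = (pA + pB) * expectation (\<lambda>\<omega>. \<gamma> (Suc n) * (X n \<omega> * (1 - X n \<omega>)))" for n
  proof -
    have "expectation (\<lambda>\<omega>. \<bar>X (Suc n) \<omega> - X n \<omega>\<bar>)
       = expectation (\<lambda>\<omega>. (pA + pB) * (\<gamma> (Suc n) * (X n \<omega> * (1 - X n \<omega>))))"
    proof (subst expectation_step[of "\<lambda>y z. \<bar>z - y\<bar>"], intro Bochner_Integration.integral_cong refl)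
      fix \<omega>
      have "\<bar>\<gamma> (Suc n) * (1 - X n \<omega>)\<bar> = \<gamma> (Suc n) * (1 - X n \<omega>)" "\<bar>\<gamma> (Suc n) * X n \<omega>\<bar> = \<gamma> (Suc n) * X n \<omega>"
        using gamma[of "Suc n"] X_bounds[of n \<omega>] by (auto simp: abs_mult)
      then show "bandit_step pA pB (\<gamma> (Suc n)) (\<lambda>z. \<bar>z - X n \<omega>\<bar>) (X n \<omega>)
        = (pA + pB) * (\<gamma> (Suc n) * (X n \<omega> * (1 - X n \<omega>)))"
        by (simp add: bandit_step_def) (simp add: algebra_simps)
    qed
    then show ?thesis by simp
  qed
  then show "summable (\<lambda>i. expectation (\<lambda>\<omega>. \<bar>X (Suc i) \<omega> - X i \<omega>\<bar>))"
    using summable_mult[OF summable_drift[OF assms]] by simp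
qed

lemma X_increment: "\<bar>X (Suc n) \<omega> - X n \<omega>\<bar> \<le> \<gamma> (Suc n)"
proof -
  have "\<gamma> (Suc n) * (1 - X n \<omega>) \<le> \<gamma> (Suc n)" "\<gamma> (Suc n) * X n \<omega> \<le> \<gamma> (Suc n)"
    using gamma[of "Suc n"] X_bounds[of n \<omega>] by (auto intro!: mult_left_le)
  then show ?thesis
    using gamma[of "Suc n"] X_bounds[of n \<omega>] by (auto simp: X_Suc abs_mult)
qed

lemma X_block:
  assumes gD: "\<And>k. k \<ge> 1 \<Longrightarrow> \<gamma> k \<le> D / real k" and m: "m \<ge> 1" and D: "0 < D"
  shows "\<bar>X (m + j) \<omega> - X m \<omega>\<bar> \<le> real j * D / real m"
proof (induction j)
  case 0
  then show ?case by simp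
next
  case (Suc j)
  have "\<gamma> (Suc (m + j)) \<le> D / real (Suc (m + j))" by (rule gD) simp
  also have "\<dots> \<le> D / real m" using m D by (intro divide_left_mono) auto
  finally have "\<bar>X (Suc (m + j)) \<omega> - X (m + j) \<omega>\<bar> \<le> D / real m"
    using X_increment[of "m + j" \<omega>] by simp
  moreover have "\<bar>X (m + Suc j) \<omega> - X m \<omega>\<bar> \<le> \<bar>X (Suc (m + j)) \<omega> - X (m + j) \<omega>\<bar> + \<bar>X (m + j) \<omega> - X m \<omega>\<bar>"
    by simp
  ultimately show ?case using Suc by (simp add: add_divide_distrib algebra_simps)
qed

lemma expectation_square_increment:
  assumes eq: "pA = pB" and gD: "\<And>k. k \<ge> 1 \<Longrightarrow> \<gamma> k \<le> D / real k" and n: "n \<ge> 1"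
  shows "expectation (\<lambda>\<omega>. (X (n + e) \<omega> - X n \<omega>)\<^sup>2) \<le> D\<^sup>2 * (1 / real n - 1 / real (n + e))"
proof -
  have "expectation (\<lambda>\<omega>. (X (n + e) \<omega> - X n \<omega>)\<^sup>2)
      = expectation (\<lambda>\<omega>. bandit_trans pB pB \<gamma> e n (\<lambda>z. (z - X n \<omega>)\<^sup>2) (X n \<omega>))"
    using integral_tower[of "\<lambda>y z. (z - y)\<^sup>2" n e] eq by simp
  also have "\<dots> \<le> (\<Sum>j=n..<n+e. (\<gamma> (Suc j))\<^sup>2)"
  proof (rule integral_le_const)
    show "integrable M (\<lambda>\<omega>. bandit_trans pB pB \<gamma> e n (\<lambda>z. (z - X n \<omega>)\<^sup>2) (X n \<omega>))"
      by (rule integrable_one_time)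
    show "AE \<omega> in M. bandit_trans pB pB \<gamma> e n (\<lambda>z. (z - X n \<omega>)\<^sup>2) (X n \<omega>) \<le> (\<Sum>j=n..<n+e. (\<gamma> (Suc j))\<^sup>2)"
    proof (rule AE_I2)
      fix \<omega>
      show "bandit_trans pB pB \<gamma> e n (\<lambda>z. (z - X n \<omega>)\<^sup>2) (X n \<omega>) \<le> (\<Sum>j=n..<n+e. (\<gamma> (Suc j))\<^sup>2)"
        using bandit_trans_square[OF pB01 gamma X_in[of n \<omega>], where e = e and n = n and a = "X n \<omega>"] by simp
    qed
  qed
  also have "\<dots> = (\<Sum>j<e. (\<gamma> (Suc (n + j)))\<^sup>2)"
    using sum.atLeastLessThan_shift_0[of "\<lambda>j. (\<gamma> (Suc j))\<^sup>2" n "n + e"]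
    by (simp add: atLeast0LessThan add.commute)
  also have "\<dots> \<le> D\<^sup>2 * (1 / real n - 1 / real (n + e))"
    using gamma by (intro sum_gamma_squares_le gD n) auto
  finally show ?thesis .
qed

text \<open>Along the squares the \<open>L\<^sup>1\<close> norms of the increments are summable, and within the block
  between two consecutive squares the steps add up to \<open>O(1 / i)\<close>.\<close>

lemma AE_convergent_balanced:
  assumes eq: "pA = pB" and gD: "\<And>k. k \<ge> 1 \<Longrightarrow> \<gamma> k \<le> D / real k" and D: "0 < D"
  shows "AE \<omega> in M. convergent (\<lambda>n. X n \<omega>)"
proof -
  define Y where "Y i = X ((Suc i)\<^sup>2)" for i
  have sq: "(Suc (Suc i))\<^sup>2 = (Suc i)\<^sup>2 + (2 * i + 3)" for i by (simp add: power2_eq_square)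
  have int2: "integrable M (\<lambda>\<omega>. (Y (Suc i) \<omega> - Y i \<omega>)\<^sup>2)" for i
    unfolding Y_def sq using integrable_two_times[of "\<lambda>y z. (z - y)\<^sup>2" "(Suc i)\<^sup>2"] by simp
  have int1: "integrable M (\<lambda>\<omega>. \<bar>Y (Suc i) \<omega> - Y i \<omega>\<bar>)" for i
    unfolding Y_def sq using integrable_two_times[of "\<lambda>y z. \<bar>z - y\<bar>" "(Suc i)\<^sup>2"] by simp
  have bound: "expectation (\<lambda>\<omega>. \<bar>Y (Suc i) \<omega> - Y i \<omega>\<bar>) \<le> (2 * D\<^sup>2 + 1) / 2 * real (Suc i) powr (- 3 / 2)" for i
  proof -
    define n where "n = real (Suc i)"
    \<comment> \<open>The second moment of the block increment is of order \<open>n^-3\<close>; t is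
      the square root of that order and the optimal weight, up to a constant, in the inequality
      \<open>2 * \<bar>z\<bar> * t \<le> z^2 + t^2\<close>, which bounds the first moment.\<close>
    define t where "t = n powr (- 3 / 2)"
    have n: "n \<ge> 1" by (simp add: n_def)
    have t: "t > 0" using n by (simp add: t_def)
    have tt: "t * t = 1 / n ^ 3"
    proof -
      have "t * t = n powr (- 3)" by (simp add: t_def powr_add[symmetric])
      also have "\<dots> = inverse (n powr 3)" by (rule powr_minus)
      also have "n powr 3 = n ^ 3" using n by (intro powr_numeral) auto
      also have "inverse (n ^ 3) = 1 / n ^ 3" by (rule inverse_eq_divide)
      finally show ?thesis .
    qed
    have "expectation (\<lambda>\<omega>. (Y (Suc i) \<omega> - Y i \<omega>)\<^sup>2) \<le> D\<^sup>2 * (1 / n\<^sup>2 - 1 / (n + 1)\<^sup>2)"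
      using expectation_square_increment[OF eq gD, of "(Suc i)\<^sup>2" "2 * i + 3"]
      unfolding Y_def sq[symmetric] by (simp add: n_def add_ac)
    also have "1 / n\<^sup>2 - 1 / (n + 1)\<^sup>2 \<le> 2 / n ^ 3"
    proof -
      have "n * n > 0" "n * n * n > 0" using n by auto
      then show ?thesis using n by (simp add: divide_simps power2_eq_square power3_eq_cube) (simp add: algebra_simps)
    qed
    finally have sqb: "expectation (\<lambda>\<omega>. (Y (Suc i) \<omega> - Y i \<omega>)\<^sup>2) \<le> D\<^sup>2 * (2 / n ^ 3)"
      by (simp add: mult_left_mono)
    have "\<bar>z\<bar> \<le> (z\<^sup>2 / t + t) / 2" for z
    proof -
      have "0 \<le> (\<bar>z\<bar> - t)\<^sup>2" by simp
      then have "2 * \<bar>z\<bar> * t \<le> z\<^sup>2 + t * t" by (simp add: power2_diff power2_eq_square[of t])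
      then show ?thesis using t by (simp add: field_simps)
    qed
    then have "expectation (\<lambda>\<omega>. \<bar>Y (Suc i) \<omega> - Y i \<omega>\<bar>) \<le> expectation (\<lambda>\<omega>. ((Y (Suc i) \<omega> - Y i \<omega>)\<^sup>2 / t + t) / 2)"
      using int1 int2 by (intro integral_mono) auto
    also have "\<dots> = (expectation (\<lambda>\<omega>. (Y (Suc i) \<omega> - Y i \<omega>)\<^sup>2) / t + t) / 2"
      using int2 by (simp add: prob_space)
    also have "\<dots> \<le> (D\<^sup>2 * (2 / n ^ 3) / t + t) / 2"
      using sqb t by (intro divide_right_mono add_right_mono) auto
    also have "D\<^sup>2 * (2 / n ^ 3) = 2 * D\<^sup>2 * (t * t)" by (simp add: tt)
    also have "(2 * D\<^sup>2 * (t * t) / t + t) / 2 = (2 * D\<^sup>2 + 1) / 2 * t" using t by (simp add: field_simps)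
    finally show ?thesis by (simp add: t_def n_def)
  qed
  have "summable (\<lambda>i. (2 * D\<^sup>2 + 1) / 2 * real (Suc i) powr (- 3 / 2))"
    by (intro summable_mult) (subst summable_Suc_iff, simp add: summable_real_powr_iff)
  then have "summable (\<lambda>i. expectation (\<lambda>\<omega>. \<bar>Y (Suc i) \<omega> - Y i \<omega>\<bar>))"
    by (rule summable_comparison_test'[where N = 0]) (use bound in auto)
  from AE_convergent_of_summable_increments[OF int1 this]
  show ?thesis
  proof eventually_elim
    case (elim \<omega>)
    then obtain l where l: "(\<lambda>i. Y i \<omega>) \<longlonglongrightarrow> l" by (auto simp: convergent_def)
    \<comment> \<open>The largest square not above k is \<open>(r k)^2\<close>. As \<open>Y\<close>
      starts at the square of 1, the value of \<open>X\<close> there is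
      \<open>Y (r k - 1)\<close>.\<close>
    define r where "r k = nat \<lfloor>sqrt (real k)\<rfloor>" for k
    have r_top: "filterlim r at_top at_top" unfolding r_def
      by (intro filterlim_compose[OF filterlim_nat_sequentially] filterlim_compose[OF filterlim_floor_sequentially]
          filterlim_compose[OF sqrt_at_top] filterlim_real_sequentially)
    have "(\<lambda>k. Y (r k - 1) \<omega>) \<longlonglongrightarrow> l"
      using filterlim_compose[OF l] filterlim_compose[OF filterlim_minus_const_nat_at_top r_top] by blast
    moreover have "(\<lambda>k. X k \<omega> - Y (r k - 1) \<omega>) \<longlonglongrightarrow> 0"
    proof (rule Lim_null_comparison)
      show "\<forall>\<^sub>F k in sequentially. norm (X k \<omega> - Y (r k - 1) \<omega>) \<le> 2 * D / real (r k)"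
        using eventually_ge_at_top[of 1]
      proof eventually_elim
        case (elim k)
        have s1: "1 \<le> sqrt (real k)" using elim by simp
        then have r1: "r k \<ge> 1" unfolding r_def by (simp add: le_nat_iff)
        have rs: "real (r k) \<le> sqrt (real k)" "sqrt (real k) < real (r k) + 1"
          unfolding r_def using s1 by (auto simp: of_nat_nat)
        have "(real (r k))\<^sup>2 \<le> (sqrt (real k))\<^sup>2" using rs by (intro power_mono) auto
        then have "real ((r k)\<^sup>2) \<le> real k" by simp
        then have lo: "(r k)\<^sup>2 \<le> k" by (simp only: of_nat_le_iff)
        have "(sqrt (real k))\<^sup>2 < (real (r k) + 1)\<^sup>2" using rs by (intro power_strict_mono) auto
        then have "real k < real ((r k + 1)\<^sup>2)" by (simp add: add.commute)
        then have hi: "k < (r k + 1)\<^sup>2" by (simp only: of_nat_less_iff)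
        define j where "j = k - (r k)\<^sup>2"
        have k: "k = (r k)\<^sup>2 + j" and j: "j \<le> 2 * r k"
          using lo hi by (auto simp: j_def power2_eq_square)
        have "\<bar>X ((r k)\<^sup>2 + j) \<omega> - X ((r k)\<^sup>2) \<omega>\<bar> \<le> real j * D / real ((r k)\<^sup>2)"
          using r1 by (intro X_block gD D) auto
        also have "\<dots> \<le> real (2 * r k) * D / real ((r k)\<^sup>2)"
          using j D by (intro divide_right_mono mult_right_mono) auto
        also have "\<dots> = 2 * D / real (r k)" using r1 by (simp add: power2_eq_square)
        finally show ?case using r1 k by (simp add: Y_def)
      qed
      show "(\<lambda>k. 2 * D / real (r k)) \<longlonglongrightarrow> 0"
        by (intro tendsto_divide_0[OF tendsto_const] filterlim_at_top_imp_at_infinity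
            filterlim_compose[OF filterlim_real_sequentially r_top])
    qed
    ultimately have "(\<lambda>k. (X k \<omega> - Y (r k - 1) \<omega>) + Y (r k - 1) \<omega>) \<longlonglongrightarrow> 0 + l"
      by (intro tendsto_add)
    then show ?case by (auto simp: convergent_def)
  qed
qed

lemma AE_convergent:
  assumes "pB \<le> pA" and "\<And>k. k \<ge> 1 \<Longrightarrow> \<gamma> k \<le> D / real k" and "0 < D"
  shows "AE \<omega> in M. convergent (\<lambda>n. X n \<omega>)"
  using AE_convergent_biased AE_convergent_balanced[OF _ assms(2,3)] assms(1) by (cases "pA = pB") auto

end

section \<open>The probability of the limit zero\<close>

context bandit_process
begin

abbreviation Xlim :: "'a \<Rightarrow> real" where "Xlim \<equiv> bandit_limit \<gamma> U A B x0"

lemma Xlim_meas [measurable]: "Xlim \<in> borel_measurable M"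
  unfolding bandit_limit_def by (intro borel_measurable_lim_metric X_meas)

lemma AE_Xlim:
  assumes "AE \<omega> in M. convergent (\<lambda>n. X n \<omega>)"
  shows "AE \<omega> in M. (\<lambda>n. X n \<omega>) \<longlonglongrightarrow> Xlim \<omega> \<and> 0 \<le> Xlim \<omega> \<and> Xlim \<omega> \<le> 1"
  using assms
proof eventually_elim
  case (elim \<omega>)
  then have l: "(\<lambda>n. X n \<omega>) \<longlonglongrightarrow> Xlim \<omega>"
    by (simp add: bandit_limit_def convergent_LIMSEQ_iff)
  have "0 \<le> Xlim \<omega>"
    by (rule LIMSEQ_le_const[OF l]) (use X_bounds less_imp_le in blast)
  moreover have "Xlim \<omega> \<le> 1"
    by (rule LIMSEQ_le_const2[OF l]) (use X_bounds in blast)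
  ultimately show ?case using l by simp
qed

text \<open>The factor \<open>h\<close> will be a test function of \<open>X n\<close>, the indicator
  of the limit event, or 1.\<close>

lemma expectation_exp_dominated:
  assumes conv: "AE \<omega> in M. convergent (\<lambda>n. X n \<omega>)" and L: "0 \<le> L" and h: "h \<in> borel_measurable M" "\<And>\<omega>. \<bar>h \<omega>\<bar> \<le> 1"
  shows "integrable M (\<lambda>\<omega>. h \<omega> * exp (- L * Xlim \<omega>))"
    and "(\<lambda>n. expectation (\<lambda>\<omega>. h \<omega> * exp (- L * X n \<omega>))) \<longlonglongrightarrow> expectation (\<lambda>\<omega>. h \<omega> * exp (- L * Xlim \<omega>))"
proof -
  note [measurable] = h(1)
  have lim: "AE \<omega> in M. (\<lambda>n. h \<omega> * exp (- L * X n \<omega>)) \<longlonglongrightarrow> h \<omega> * exp (- L * Xlim \<omega>)"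
    using AE_Xlim[OF conv] by eventually_elim (auto intro!: tendsto_intros)
  have bd: "AE \<omega> in M. norm (h \<omega> * exp (- L * X n \<omega>)) \<le> 1" for n
  proof (rule AE_I2)
    fix \<omega>
    have "\<bar>h \<omega>\<bar> * exp (- L * X n \<omega>) \<le> 1 * 1"
      using h(2) L X_bounds[of n \<omega>] by (intro mult_mono) (auto simp: less_imp_le)
    then show "norm (h \<omega> * exp (- L * X n \<omega>)) \<le> 1" by (simp add: abs_mult)
  qed
  show "integrable M (\<lambda>\<omega>. h \<omega> * exp (- L * Xlim \<omega>))"
    by (rule integrable_dominated_convergence[OF _ _ _ lim bd]) auto
  show "(\<lambda>n. expectation (\<lambda>\<omega>. h \<omega> * exp (- L * X n \<omega>))) \<longlonglongrightarrow> expectation (\<lambda>\<omega>. h \<omega> * exp (- L * Xlim \<omega>))"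
    by (rule integral_dominated_convergence[OF _ _ _ lim bd]) auto
qed

text \<open>Conditionally on the past the probability of \<open>{Xlim = 0}\<close> is at most a constant \<open>q < 1\<close>;
  testing this against functions of \<open>X n\<close> that approximate the indicator of the same event yields
  \<open>P(Xlim = 0) \<le> q P(Xlim = 0)\<close>.\<close>

lemma prob_limit_zero_null:
  assumes p: "0 < pB" "pB \<le> pA"
    and c: "0 < c" and gc: "\<And>k. k \<ge> 1 \<Longrightarrow> c / real k \<le> \<gamma> k"
    and D: "0 < D" and gD: "\<And>k. k \<ge> 1 \<Longrightarrow> \<gamma> k \<le> D / real k"
    and ns: "\<not> summable (\<lambda>k. \<Prod>j=1..k. 1 - pB * \<gamma> j)"
  shows "prob {\<omega> \<in> space M. Xlim \<omega> = 0} = 0"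
proof -
  define E where "E = {\<omega> \<in> space M. Xlim \<omega> = 0}"
  have [measurable]: "E \<in> events" unfolding E_def by measurable
  have conv: "AE \<omega> in M. convergent (\<lambda>n. X n \<omega>)"
    using p(2) gD D by (rule AE_convergent)
  \<comment> \<open>Chosen so that both requirements of \<open>rate_increment\<close> hold.\<close>
  define a where "a = D + 2 * D\<^sup>2"
  define q where "q = exp (- c / (a + 1))"
  define N where "N = max 1 (nat \<lceil>2 * D\<rceil>)"
  have a: "D \<le> a" "2 * D\<^sup>2 \<le> a" using D by (auto simp: a_def)
  have q: "0 \<le> q" "q < 1" using c a D by (auto simp: q_def)
  have half: "\<gamma> k \<le> 1 / 2" if "k > N" for k
  proof -
    have k: "k \<ge> 1" "2 * D \<le> real k" using that unfolding N_def by linarith+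
    have "D / real k \<le> 1 / 2" using k by (simp add: field_simps)
    then show ?thesis using gD[OF k(1)] by linarith
  qed
  \<comment> \<open>L and m are fixed before e, so the final time can go to infinity at a fixed rate
    L.\<close>
  have step1: "\<exists>L\<ge>0. \<exists>m. \<forall>e. expectation (\<lambda>\<omega>. exp (- l * X n \<omega>) * exp (- L * X (e + m) \<omega>))
      \<le> (q + \<eta>) * expectation (\<lambda>\<omega>. exp (- l * X n \<omega>))"
    if n: "n \<ge> N" and l: "0 \<le> l" and \<eta>: "0 < \<eta>" for n l \<eta>
  proof -
    have n1: "n \<ge> 1" using n by (simp add: N_def)
    obtain \<delta> where \<delta>: "\<delta> > 0" "\<And>\<omega>. \<delta> \<le> X n \<omega>" using X_lower[of n] by auto
    \<comment> \<open>A bound, uniform in d, for the factors \<open>1 + 4 * g^2\<close> accumulated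
      along the killed chain.\<close>
    define K where "K = exp (4 * D\<^sup>2)"
    have K: "(\<Prod>j<d. 1 + 4 * (\<gamma> (Suc (n + j)))\<^sup>2) \<le> K" for d
    proof -
      have "(\<Prod>j<d. 1 + 4 * (\<gamma> (Suc (n + j)))\<^sup>2) \<le> (\<Prod>j<d. exp (4 * (\<gamma> (Suc (n + j)))\<^sup>2))"
        by (intro prod_mono conjI exp_ge_add_one_self) (auto intro: add_nonneg_nonneg)
      also have "\<dots> = exp (4 * (\<Sum>j<d. (\<gamma> (Suc (n + j)))\<^sup>2))" by (simp add: exp_sum sum_distrib_left)
      also have "(\<Sum>j<d. (\<gamma> (Suc (n + j)))\<^sup>2) \<le> D\<^sup>2 * (1 / real n - 1 / real (n + d))"
        using gamma by (intro sum_gamma_squares_le gD n1) auto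
      also have "\<dots> \<le> D\<^sup>2 * 1"
      proof (rule mult_left_mono)
        have "1 / real n \<le> 1" using n1 by simp
        moreover have "0 \<le> 1 / real (n + d)" by simp
        ultimately show "1 / real n - 1 / real (n + d) \<le> 1" by linarith
      qed simp
      finally show ?thesis by (simp add: K_def)
    qed
    have "filterlim (\<lambda>d. \<Sum>k<d. \<Prod>j<k. 1 - pB * \<gamma> (Suc (n + j))) at_top at_top"
      using pB01 gamma ns by (intro filterlim_shifted_products) auto
    \<comment> \<open>The threshold makes \<open>K / (1 + x * V)\<close> at most
      \<open>\<eta>\<close> for every state \<open>x \<ge> \<delta>\<close>.\<close>
    then have "\<forall>\<^sub>F d in sequentially. K / (\<eta> * \<delta> * (pB / 2)) \<le> (\<Sum>k<d. \<Prod>j<k. 1 - pB * \<gamma> (Suc (n + j)))"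
      by (simp add: filterlim_at_top)
    then obtain d where d: "K / (\<eta> * \<delta> * (pB / 2)) \<le> (\<Sum>k<d. \<Prod>j<k. 1 - pB * \<gamma> (Suc (n + j)))"
      by (auto simp: eventually_sequentially)
    have V: "K \<le> \<eta> * (\<delta> * survival_weight pB \<gamma> d n)"
      using d p \<eta> \<delta> by (simp add: survival_weight_eq field_simps)
    have V0: "0 \<le> survival_weight pB \<gamma> d n"
      using pB01 gamma by (intro survival_weight_nonneg) auto
    define L where "L = real (n + d)"
    have L: "0 < L" using n1 by (simp add: L_def)
    have "expectation (\<lambda>\<omega>. exp (- l * X n \<omega>) * exp (- L * X (e + (n + d)) \<omega>))
      \<le> (q + \<eta>) * expectation (\<lambda>\<omega>. exp (- l * X n \<omega>))" for e
    proof -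
      let ?f = "\<lambda>x. bandit_trans pA pB \<gamma> (d + e) n (\<lambda>z. exp (- l * x) * exp (- L * z)) x"
      have lin: "bandit_trans pA pB \<gamma> k m (\<lambda>z. C * f z) = (\<lambda>x. C * bandit_trans pA pB \<gamma> k m f x)" for k m C f
        by (induction k arbitrary: m) (auto simp: bandit_step_def algebra_simps)
      have idx: "n + (d + e) = e + (n + d)" by simp
      have "expectation (\<lambda>\<omega>. exp (- l * X n \<omega>) * exp (- L * X (e + (n + d)) \<omega>)) = expectation (\<lambda>\<omega>. ?f (X n \<omega>))"
        using integral_tower[of "\<lambda>y z. exp (- l * y) * exp (- L * z)" n "d + e"] by (simp only: idx)
      also have "\<dots> \<le> expectation (\<lambda>\<omega>. (q + \<eta>) * exp (- l * X n \<omega>))"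
      proof (rule integral_mono)
        fix \<omega>
        have "bandit_trans pA pB \<gamma> (d + e) n (\<lambda>x. exp (- L * x)) (X n \<omega>)
            \<le> q + (\<Prod>j<d. 1 + 4 * (\<gamma> (Suc (n + j)))\<^sup>2) / (1 + X n \<omega> * survival_weight pB \<gamma> d n)"
          unfolding q_def using p pA01 gamma D a L gD c gc half n X_in
          by (intro bandit_trans_first_win) (auto simp: L_def)
        also have "(\<Prod>j<d. 1 + 4 * (\<gamma> (Suc (n + j)))\<^sup>2) / (1 + X n \<omega> * survival_weight pB \<gamma> d n) \<le> \<eta>"
        proof -
          have le: "\<delta> * survival_weight pB \<gamma> d n \<le> X n \<omega> * survival_weight pB \<gamma> d n"
            using \<delta> V0 by (intro mult_right_mono) auto
          have pos: "0 < 1 + X n \<omega> * survival_weight pB \<gamma> d n"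
            using V0 X_bounds[of n \<omega>] by (intro add_pos_nonneg mult_nonneg_nonneg) auto
          have "K \<le> \<eta> * (1 + X n \<omega> * survival_weight pB \<gamma> d n)"
          proof -
            have "K \<le> \<eta> * (X n \<omega> * survival_weight pB \<gamma> d n)"
              by (rule order_trans[OF V mult_left_mono[OF le]]) (use \<eta> in simp)
            then show ?thesis using \<eta> unfolding distrib_left by linarith
          qed
          then show ?thesis using K[of d] pos by (simp add: pos_divide_le_eq)
        qed
        finally have "bandit_trans pA pB \<gamma> (d + e) n (\<lambda>x. exp (- L * x)) (X n \<omega>) \<le> q + \<eta>" by simp
        then show "?f (X n \<omega>) \<le> (q + \<eta>) * exp (- l * X n \<omega>)"
          unfolding lin by (simp add: mult.commute)
      qed (rule integrable_one_time)+
      finally show ?thesis by simp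
    qed
    then show ?thesis using L by (intro exI[of _ L] conjI exI[of _ "n + d"]) auto
  qed
  have intE: "integrable M (\<lambda>\<omega>. exp (- l * X n \<omega>) * indicator E \<omega>)" if "0 \<le> l" for l n
    by (intro integrable_real_mult_indicator integrable_one_time) auto
  have step2: "expectation (\<lambda>\<omega>. exp (- l * X n \<omega>) * indicator E \<omega>) \<le> q * expectation (\<lambda>\<omega>. exp (- l * X n \<omega>))"
    if n: "n \<ge> N" and l: "0 \<le> l" for n l
  proof -
    have e1: "expectation (\<lambda>\<omega>. exp (- l * X n \<omega>)) \<le> 1"
      using X_bounds l by (intro integral_le_const integrable_one_time) (auto simp: less_imp_le)
    have "expectation (\<lambda>\<omega>. exp (- l * X n \<omega>) * indicator E \<omega>) \<le> q * expectation (\<lambda>\<omega>. exp (- l * X n \<omega>)) + \<eta>"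
      if \<eta>: "0 < \<eta>" for \<eta>
    proof -
      obtain L m where L: "0 \<le> L" and
        bd: "\<And>e. expectation (\<lambda>\<omega>. exp (- l * X n \<omega>) * exp (- L * X (e + m) \<omega>))
          \<le> (q + \<eta>) * expectation (\<lambda>\<omega>. exp (- l * X n \<omega>))"
        using step1[OF n l \<eta>] by auto
      have "\<bar>exp (- l * X n \<omega>)\<bar> \<le> 1" for \<omega> using l X_bounds[of n \<omega>] by (simp add: less_imp_le)
      note dom = expectation_exp_dominated[OF conv L, of "\<lambda>\<omega>. exp (- l * X n \<omega>)", OF _ this]
      \<comment> \<open>The indicator of \<open>E\<close> is at most
        \<open>exp (- L * Xlim \<omega>)\<close>, to which the bound on the finite-time exponentials
        passes by dominated convergence.\<close>
      have "expectation (\<lambda>\<omega>. exp (- l * X n \<omega>) * indicator E \<omega>)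
          \<le> expectation (\<lambda>\<omega>. exp (- l * X n \<omega>) * exp (- L * Xlim \<omega>))"
        using dom(1) intE[OF l] by (intro integral_mono) (auto simp: indicator_def E_def)
      also have "\<dots> \<le> (q + \<eta>) * expectation (\<lambda>\<omega>. exp (- l * X n \<omega>))"
      proof (rule LIMSEQ_le_const2[OF LIMSEQ_ignore_initial_segment])
        show "(\<lambda>n'. expectation (\<lambda>\<omega>. exp (- l * X n \<omega>) * exp (- L * X n' \<omega>)))
            \<longlonglongrightarrow> expectation (\<lambda>\<omega>. exp (- l * X n \<omega>) * exp (- L * Xlim \<omega>))"
          by (rule dom(2)) measurable
      qed (use bd in blast)
      also have "\<dots> \<le> q * expectation (\<lambda>\<omega>. exp (- l * X n \<omega>)) + \<eta>"
        using e1 \<eta> by (simp add: algebra_simps mult_left_le)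
      finally show ?thesis .
    qed
    then show ?thesis by (rule field_le_epsilon)
  qed
  \<comment> \<open>Let n tend to infinity in \<open>step2\<close>: the limit is 0 on
    \<open>E\<close>, so the test function tends to 1 there.\<close>
  have step3: "prob E \<le> q * expectation (\<lambda>\<omega>. exp (- l * Xlim \<omega>))" if l: "0 \<le> l" for l
  proof -
    have 1: "(\<lambda>n. expectation (\<lambda>\<omega>. indicator E \<omega> * exp (- l * X n \<omega>))) \<longlonglongrightarrow> expectation (\<lambda>\<omega>. indicator E \<omega> * exp (- l * Xlim \<omega>))"
      by (rule expectation_exp_dominated[OF conv l]) (auto simp: indicator_def)
    have 2: "(\<lambda>n. q * expectation (\<lambda>\<omega>. 1 * exp (- l * X n \<omega>))) \<longlonglongrightarrow> q * expectation (\<lambda>\<omega>. 1 * exp (- l * Xlim \<omega>))"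
      by (intro tendsto_mult tendsto_const expectation_exp_dominated[OF conv l]) auto
    have "expectation (\<lambda>\<omega>. indicator E \<omega> * exp (- l * Xlim \<omega>)) \<le> q * expectation (\<lambda>\<omega>. 1 * exp (- l * Xlim \<omega>))"
      by (rule LIMSEQ_le[OF 1 2]) (use step2 l in \<open>auto simp: mult.commute intro!: exI[of _ N]\<close>)
    also have "(\<lambda>\<omega>. indicator E \<omega> * exp (- l * Xlim \<omega>)) = indicator E"
      by (auto simp: indicator_def E_def fun_eq_iff)
    finally show ?thesis by simp
  qed
  \<comment> \<open>The exponentials tend to the indicator of \<open>E\<close> as their rate grows,
    which turns \<open>step3\<close> into \<open>prob E \<le> q * prob E\<close>.\<close>
  have "(\<lambda>i. expectation (\<lambda>\<omega>. exp (- real i * Xlim \<omega>))) \<longlonglongrightarrow> expectation (indicator E)"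
  proof (rule integral_dominated_convergence[where w = "\<lambda>_. 1"])
    show "AE \<omega> in M. (\<lambda>i. exp (- real i * Xlim \<omega>)) \<longlonglongrightarrow> indicator E \<omega>"
      using AE_Xlim[OF conv] AE_space
    proof eventually_elim
      case (elim \<omega>)
      show ?case
      proof (cases "Xlim \<omega> = 0")
        case True
        then show ?thesis using elim by (simp add: E_def)
      next
        case False
        then have "Xlim \<omega> > 0" using elim by simp
        then have "exp (- Xlim \<omega>) < 1" by simp
        then have "(\<lambda>i. exp (- Xlim \<omega>) ^ i) \<longlonglongrightarrow> 0" by (intro LIMSEQ_power_zero) simp
        then show ?thesis using False by (simp add: E_def exp_of_nat_mult[symmetric])
      qed
    qed
    show "AE \<omega> in M. norm (exp (- real i * Xlim \<omega>)) \<le> 1" for i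
      using AE_Xlim[OF conv] by eventually_elim simp
  qed auto
  then have "(\<lambda>i. q * expectation (\<lambda>\<omega>. exp (- real i * Xlim \<omega>))) \<longlonglongrightarrow> q * prob E"
    by (intro tendsto_mult tendsto_const) simp
  then have "prob E \<le> q * prob E"
    by (rule LIMSEQ_le_const) (use step3[OF of_nat_0_le_iff] in blast)
  then have "(1 - q) * prob E \<le> 0" by (simp add: algebra_simps)
  then have "prob E \<le> 0" using q by (simp add: mult_le_0_iff)
  then show ?thesis using measure_nonneg[of M E] unfolding E_def by linarith
qed

text \<open>Almost surely the sum of
  \<open>\<gamma> (Suc n) * (X n \<omega> * (1 - X n \<omega>))\<close> is finite. A limit strictly
  between 0 and 1 would bound \<open>X n \<omega> * (1 - X n \<omega>)\<close> below and make the
  sum of the steps finite as well.\<close>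

lemma prob_limit_one:
  assumes p: "pB < pA" and conv: "AE \<omega> in M. convergent (\<lambda>n. X n \<omega>)"
    and zero: "prob {\<omega> \<in> space M. Xlim \<omega> = 0} = 0" and ns: "\<not> summable (\<lambda>n. \<gamma> (Suc n))"
  shows "prob {\<omega> \<in> space M. Xlim \<omega> = 1} = 1"
proof -
  have "AE \<omega> in M. summable (\<lambda>n. \<gamma> (Suc n) * (X n \<omega> * (1 - X n \<omega>)))"
  proof (rule AE_summable_of_summable_integral[OF _ _ summable_drift[OF p]])
    show "integrable M (\<lambda>\<omega>. \<gamma> (Suc n) * (X n \<omega> * (1 - X n \<omega>)))" for n
      by (rule integrable_one_time)
    show "0 \<le> \<gamma> (Suc n) * (X n \<omega> * (1 - X n \<omega>))" for n \<omega>
      using gamma[of "Suc n"] X_bounds[of n \<omega>] by (intro mult_nonneg_nonneg) auto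
  qed
  moreover have "AE \<omega> in M. Xlim \<omega> \<noteq> 0"
  proof -
    have "{\<omega> \<in> space M. Xlim \<omega> = 0} \<in> events" by measurable
    then have "AE \<omega> in M. \<omega> \<notin> {\<omega> \<in> space M. Xlim \<omega> = 0}"
      using zero by (simp add: prob_eq_0)
    then show ?thesis using AE_space by eventually_elim auto
  qed
  ultimately have "AE \<omega> in M. Xlim \<omega> = 1"
    using AE_Xlim[OF conv]
  proof eventually_elim
    case (elim \<omega>)
    show ?case
    proof (rule ccontr)
      assume "Xlim \<omega> \<noteq> 1"
      define b where "b = Xlim \<omega> * (1 - Xlim \<omega>)"
      have b: "b > 0" using elim \<open>Xlim \<omega> \<noteq> 1\<close> by (auto simp: b_def)
      have "(\<lambda>n. X n \<omega> * (1 - X n \<omega>)) \<longlonglongrightarrow> b"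
        unfolding b_def using elim by (intro tendsto_intros) auto
      then have "\<forall>\<^sub>F n in sequentially. b / 2 < X n \<omega> * (1 - X n \<omega>)"
        using b by (intro order_tendstoD) auto
      then have ev: "\<forall>\<^sub>F n in sequentially. norm (\<gamma> (Suc n)) \<le> 2 / b * (\<gamma> (Suc n) * (X n \<omega> * (1 - X n \<omega>)))"
      proof eventually_elim
        case (elim n)
        have "\<gamma> (Suc n) * (b / 2) \<le> \<gamma> (Suc n) * (X n \<omega> * (1 - X n \<omega>))"
          using elim gamma[of "Suc n"] by (intro mult_left_mono) auto
        then show ?case using b gamma[of "Suc n"] by (simp add: field_simps)
      qed
      have "summable (\<lambda>n. 2 / b * (\<gamma> (Suc n) * (X n \<omega> * (1 - X n \<omega>))))"
        using elim(1) by (rule summable_mult)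
      with ev have "summable (\<lambda>n. \<gamma> (Suc n))"
        by (rule summable_comparison_test_ev)
      then show False using ns by simp
    qed
  qed
  then show ?thesis by (simp add: prob_Collect_eq_1)
qed

text \<open>If A is not tried, a step shrinks the state on average by \<open>1 - pB * h\<close>; the
  survival factor \<open>1 - w\<close> is simply bounded by 1.\<close>

lemma bandit_surv_id_le:
  assumes "w \<in> {0<..1}"
  shows "bandit_surv pB \<gamma> d n (\<lambda>x. x) w \<le> w * (\<Prod>j<d. 1 - pB * \<gamma> (Suc (n + j)))"
  using assms
proof (induction d arbitrary: n w)
  case 0
  then show ?case by simp
next
  case (Suc d)
  define P where "P = (\<Prod>j<d. 1 - pB * \<gamma> (Suc (Suc n + j)))"
  define h where "h = \<gamma> (Suc n)"
  have pos: "0 < 1 - pB * \<gamma> k" if "k \<ge> 1" for k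
    using shrink_factor_pos[of pB "\<gamma> k"] pB01 gamma[OF that] by simp
  have P: "0 \<le> P" unfolding P_def using pos by (intro prod_nonneg) (simp add: less_imp_le)
  have h: "0 < h" "h < 1" "0 \<le> 1 - pB * h" using gamma[of "Suc n"] pos[of "Suc n"] by (auto simp: h_def)
  have IH: "bandit_surv pB \<gamma> d (Suc n) (\<lambda>x. x) z \<le> z * P" if "z \<in> {0<..1}" for z
    unfolding P_def using that by (rule Suc.IH)
  have "bandit_surv pB \<gamma> (Suc d) n (\<lambda>x. x) w \<le> (1 - w) * (pB * ((w - h * w) * P) + (1 - pB) * (w * P))"
    unfolding bandit_surv.simps h_def[symmetric] using pB01 Suc.prems loss_in_unit[of h w] h
    by (intro mult_left_mono add_mono IH) auto
  also have "\<dots> = (1 - w) * (w * ((1 - pB * h) * P))" by (simp add: algebra_simps)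
  also have "\<dots> \<le> 1 * (w * ((1 - pB * h) * P))"
    using Suc.prems P h by (intro mult_right_mono mult_nonneg_nonneg) auto
  also have "\<dots> = w * (\<Prod>j<Suc d. 1 - pB * \<gamma> (Suc (n + j)))"
    by (simp only: prod.lessThan_Suc_shift) (simp add: P_def h_def)
  finally show ?case .
qed

text \<open>A union bound in recursive form: the probability of a first trial of A after k steps is
  at most the mean state on surviving paths, hence at most \<open>w\<close> times the product of k
  shrink factors.\<close>

lemma bandit_surv_one_ge:
  assumes "w \<in> {0<..1}"
  shows "1 - w * (\<Sum>k<d. \<Prod>j<k. 1 - pB * \<gamma> (Suc (n + j))) \<le> bandit_surv pB \<gamma> d n (\<lambda>_. 1) w"
  using assms
proof (induction d arbitrary: n w)
  case 0
  then show ?case by simp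
next
  case (Suc d)
  define T where "T = (\<Sum>k<d. \<Prod>j<k. 1 - pB * \<gamma> (Suc (Suc n + j)))"
  define h where "h = \<gamma> (Suc n)"
  have pos: "0 < 1 - pB * \<gamma> k" if "k \<ge> 1" for k
    using shrink_factor_pos[of pB "\<gamma> k"] pB01 gamma[OF that] by simp
  have T: "0 \<le> T" unfolding T_def using pos by (intro sum_nonneg prod_nonneg) (simp add: less_imp_le)
  have h: "0 < h" "h < 1" "0 \<le> 1 - pB * h" using gamma[of "Suc n"] pos[of "Suc n"] by (auto simp: h_def)
  have IH: "1 - z * T \<le> bandit_surv pB \<gamma> d (Suc n) (\<lambda>_. 1) z" if "z \<in> {0<..1}" for z
    unfolding T_def using that by (rule Suc.IH)
  have S: "(\<Sum>k<Suc d. \<Prod>j<k. 1 - pB * \<gamma> (Suc (n + j))) = 1 + (1 - pB * h) * T"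
    unfolding T_def h_def by (simp only: sum.lessThan_Suc_shift prod.lessThan_Suc_shift sum_distrib_left) simp
  have "0 \<le> w * (w * ((1 - pB * h) * T))"
    using Suc.prems h T by (intro mult_nonneg_nonneg) auto
  then have "1 - w * (1 + (1 - pB * h) * T) \<le> (1 - w) * (pB * (1 - (w - h * w) * T) + (1 - pB) * (1 - w * T))"
    by (simp add: algebra_simps)
  also have "\<dots> \<le> bandit_surv pB \<gamma> (Suc d) n (\<lambda>_. 1) w"
    unfolding bandit_surv.simps h_def[symmetric] using pB01 Suc.prems loss_in_unit[of h w] h
    by (intro mult_left_mono add_mono IH) auto
  finally show ?case by (simp only: S)
qed

lemma prob_limit_zero_pos:
  assumes sum: "summable (\<lambda>k. \<Prod>j=1..k. 1 - pB * \<gamma> j)"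
    and small: "x0 * (\<Sum>k. \<Prod>j=1..k. 1 - pB * \<gamma> j) \<le> 1 / 2"
  shows "prob {\<omega> \<in> space M. Xlim \<omega> = 0} \<noteq> 0"
proof -
  let ?P = "\<lambda>k. \<Prod>j=1..k. 1 - pB * \<gamma> j"
  have pos: "0 < 1 - pB * \<gamma> k" if "k \<ge> 1" for k
    using shrink_factor_pos[of pB "\<gamma> k"] pB01 gamma[OF that] by simp
  have eq: "(\<Prod>j<k. 1 - pB * \<gamma> (Suc (0 + j))) = ?P k" for k
    using prod.atLeast1_atMost_eq[of "\<lambda>j. 1 - pB * \<gamma> j" k] by simp
  have P0: "0 \<le> ?P k" for k using pos by (intro prod_nonneg) (simp add: less_imp_le)
  define R where "R = (\<Inter>d. no_try 0 d)"
  have [measurable]: "R \<in> events" unfolding R_def by auto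
  have "1 / 2 \<le> prob (no_try 0 d)" for d
  proof -
    have "prob (no_try 0 d) = bandit_surv pB \<gamma> d 0 (\<lambda>_. 1) x0"
      using has_bochner_integral_integral_eq[OF integral_no_try_start[of d "\<lambda>_. 1"]] by simp
    moreover have "1 - x0 * (\<Sum>k<d. ?P k) \<le> bandit_surv pB \<gamma> d 0 (\<lambda>_. 1) x0"
      using bandit_surv_one_ge[OF x0, where d = d and n = 0] by (simp only: eq)
    moreover have "x0 * (\<Sum>k<d. ?P k) \<le> x0 * (\<Sum>k. ?P k)"
      using x0 P0 by (intro mult_left_mono sum_le_suminf sum) auto
    ultimately show ?thesis using small by linarith
  qed
  moreover have "(\<lambda>d. prob (no_try 0 d)) \<longlonglongrightarrow> prob R"
    unfolding R_def by (rule finite_Lim_measure_decseq) (auto simp: decseq_def no_try_def)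
  ultimately have R: "1 / 2 \<le> prob R"
    by (intro LIMSEQ_le_const[where X = "\<lambda>d. prob (no_try 0 d)"]) auto
  have int: "integrable M (\<lambda>\<omega>. indicator (no_try 0 d) \<omega> * X d \<omega>)" for d
    using integral_no_try_start[of d "\<lambda>x. x"] by (rule integrable.intros)
  \<comment> \<open>On \<open>R\<close> all indicators are 1, so summability yields convergence to 0
    directly. This also covers steps decaying more slowly than \<open>1 / k\<close>, for which no
    general convergence statement has been established here when \<open>pA = pB\<close>.\<close>
  have "AE \<omega> in M. summable (\<lambda>d. indicator (no_try 0 d) \<omega> * X d \<omega>)"
  proof (rule AE_summable_of_summable_integral[OF int])
    show "0 \<le> indicator (no_try 0 d) \<omega> * X d \<omega>" for d \<omega>
      using X_bounds[of d \<omega>] by simp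
    have "norm (expectation (\<lambda>\<omega>. indicator (no_try 0 d) \<omega> * X d \<omega>)) \<le> x0 * ?P d" for d
    proof -
      have "expectation (\<lambda>\<omega>. indicator (no_try 0 d) \<omega> * X d \<omega>) = bandit_surv pB \<gamma> d 0 (\<lambda>x. x) x0"
        by (rule has_bochner_integral_integral_eq[OF integral_no_try_start[of d "\<lambda>x. x"]])
      also have "\<dots> \<le> x0 * ?P d"
        using bandit_surv_id_le[OF x0, where d = d and n = 0] by (simp only: eq)
      finally have "expectation (\<lambda>\<omega>. indicator (no_try 0 d) \<omega> * X d \<omega>) \<le> x0 * ?P d" .
      moreover have "0 \<le> expectation (\<lambda>\<omega>. indicator (no_try 0 d) \<omega> * X d \<omega>)"
        using X_bounds by (intro Bochner_Integration.integral_nonneg) (simp add: less_imp_le)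
      ultimately show ?thesis by simp
    qed
    then show "summable (\<lambda>d. expectation (\<lambda>\<omega>. indicator (no_try 0 d) \<omega> * X d \<omega>))"
      by (intro summable_comparison_test'[OF summable_mult[OF sum, of x0], where N = 0])
  qed
  then have "AE \<omega> in M. \<omega> \<in> R \<longrightarrow> \<omega> \<in> {\<omega> \<in> space M. Xlim \<omega> = 0}"
    using AE_space
  proof eventually_elim
    case (elim \<omega>)
    show ?case
    proof
      assume "\<omega> \<in> R"
      then have "summable (\<lambda>d. X d \<omega>)" using elim by (simp add: R_def)
      then have "(\<lambda>d. X d \<omega>) \<longlonglongrightarrow> 0" by (rule summable_LIMSEQ_zero)
      then show "\<omega> \<in> {\<omega> \<in> space M. Xlim \<omega> = 0}" using elim by (simp add: bandit_limit_def limI)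
    qed
  qed
  then have "prob R \<le> prob {\<omega> \<in> space M. Xlim \<omega> = 0}"
    by (intro finite_measure_mono_AE) auto
  then show ?thesis using R by linarith
qed

end

section \<open>Summability for the two families of steps\<close>

text \<open>Raabe's test: the ratio of consecutive products exceeds 1 by at least
  \<open>p * \<gamma> (Suc n)\<close>. The test multiplies by n rather than \<open>Suc n\<close>, so
  part of the margin is given up and \<open>(1 + \<beta>) / 2\<close> replaces
  \<open>\<beta>\<close>.\<close>

lemma summable_shrink_products:
  fixes p :: real and \<gamma> :: "nat \<Rightarrow> real"
  assumes p: "0 < p" "p \<le> 1" and g: "\<And>k. k \<ge> 1 \<Longrightarrow> 0 < \<gamma> k \<and> \<gamma> k < 1"
    and \<beta>: "1 < \<beta>" and ev: "\<forall>\<^sub>F n in sequentially. \<beta> \<le> real n * (p * \<gamma> n)"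
  shows "summable (\<lambda>k. \<Prod>j=1..k. 1 - p * \<gamma> j)"
proof (rule raabes_test_convergence)
  let ?f = "\<lambda>k. \<Prod>j=1..k. 1 - p * \<gamma> j"
  have pos: "0 < 1 - p * \<gamma> k" if "k \<ge> 1" for k
    using shrink_factor_pos[of p "\<gamma> k"] p g[OF that] by simp
  have f: "?f k > 0" for k using pos by (intro prod_pos) auto
  show "\<forall>\<^sub>F n in sequentially. 0 < ?f n" using f by simp
  have lim: "(\<lambda>n. \<beta> * (real n / real (Suc n))) \<longlonglongrightarrow> \<beta> * 1"
    by (intro tendsto_mult tendsto_const LIMSEQ_n_over_Suc_n)
  have "\<forall>\<^sub>F n in sequentially. (1 + \<beta>) / 2 < \<beta> * (real n / real (Suc n))"
    using \<beta> by (intro order_tendstoD(1)[OF lim]) auto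
  moreover have "\<forall>\<^sub>F n in sequentially. \<beta> \<le> real (Suc n) * (p * \<gamma> (Suc n))"
    using ev by (rule eventually_sequentially_Suc[THEN iffD2])
  ultimately have "\<forall>\<^sub>F n in sequentially. ereal ((1 + \<beta>) / 2) \<le> ereal (real n * (?f n / ?f (Suc n) - 1))"
  proof eventually_elim
    case (elim n)
    define h where "h = p * \<gamma> (Suc n)"
    have h: "0 < 1 - h" "0 \<le> h" using pos[of "Suc n"] p g[of "Suc n"] by (auto simp: h_def)
    have "\<beta> / real (Suc n) \<le> h" using elim(2) by (simp add: h_def field_simps)
    also have "h \<le> 1 / (1 - h) - 1" using h by (simp add: field_simps)
    also have "1 / (1 - h) = ?f n / ?f (Suc n)"
    proof -
      have "?f (Suc n) = ?f n * (1 - h)" by (simp add: h_def)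
      moreover have "c / (c * (1 - h)) = 1 / (1 - h)" if "0 < c" for c using that by simp
      ultimately show ?thesis using f[of n] by metis
    qed
    finally have "real n * (\<beta> / real (Suc n)) \<le> real n * (?f n / ?f (Suc n) - 1)"
      by (intro mult_left_mono) auto
    moreover have "\<beta> * (real n / real (Suc n)) = real n * (\<beta> / real (Suc n))" by simp
    ultimately have "(1 + \<beta>) / 2 \<le> real n * (?f n / ?f (Suc n) - 1)" using elim(1) by linarith
    then show ?case by (simp only: ereal_less_eq)
  qed
  then have "ereal ((1 + \<beta>) / 2) \<le> liminf (\<lambda>n. ereal (real n * (?f n / ?f (Suc n) - 1)))"
    by (rule Liminf_bounded)
  moreover have "1 < ereal ((1 + \<beta>) / 2)" using \<beta> by simp
  ultimately show "1 < liminf (\<lambda>n. ereal (real n * (?f n / ?f (Suc n) - 1)))"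
    by (rule less_le_trans[rotated])
qed

lemma power_steps_bounds:
  assumes "0 < C" "0 < \<alpha>" "n \<ge> 1"
  shows "0 < power_steps C \<alpha> n" "power_steps C \<alpha> n < 1"
proof -
  have b: "0 < C / (real n + C)" "C / (real n + C) < 1" using assms by auto
  show "0 < power_steps C \<alpha> n" unfolding power_steps_def using b assms by auto
  have "(C / (real n + C)) powr \<alpha> < 1 powr \<alpha>" using b assms by (intro powr_less_mono2) auto
  then show "power_steps C \<alpha> n < 1" by (simp add: power_steps_def)
qed

lemma summable_power_steps:
  assumes p: "0 < p" "p \<le> 1" and C: "0 < C" and \<alpha>: "0 < \<alpha>" "\<alpha> \<le> 1" and bad: "\<not> (\<alpha> = 1 \<and> C \<le> 1 / p)"
  shows "summable (\<lambda>k. \<Prod>j=1..k. 1 - p * power_steps C \<alpha> j)"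
proof (cases "\<alpha> = 1")
  case True
  define b where "b = p * C"
  have b: "1 < b" using True bad p by (simp add: b_def field_simps)
  have "(\<lambda>n. real n * (p * (C / (real n + C)))) \<longlonglongrightarrow> b"
    unfolding b_def using C p by real_asymp
  then have "\<forall>\<^sub>F n in sequentially. (1 + b) / 2 < real n * (p * (C / (real n + C)))"
    by (rule order_tendstoD(1)) (use b in simp)
  then have "\<forall>\<^sub>F n in sequentially. (1 + b) / 2 \<le> real n * (p * power_steps C \<alpha> n)"
    by eventually_elim (use True C in \<open>simp add: power_steps_def\<close>)
  then show ?thesis
    using p b power_steps_bounds[OF C \<alpha>(1)] by (intro summable_shrink_products[where \<beta> = "(1 + b) / 2"]) auto
next
  case False
  then have "\<alpha> < 1" using \<alpha> by simp
  then have "filterlim (\<lambda>n. real n * (p * (C / (real n + C)) powr \<alpha>)) at_top at_top"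
    using C p \<alpha> by real_asymp
  then have "\<forall>\<^sub>F n in sequentially. 2 \<le> real n * (p * power_steps C \<alpha> n)"
    unfolding power_steps_def by (simp only: filterlim_at_top)
  then show ?thesis
    using p power_steps_bounds[OF C \<alpha>(1)] by (intro summable_shrink_products[where \<beta> = 2]) auto
qed

lemma power_steps_one: "0 < C \<Longrightarrow> power_steps C 1 n = C / (real n + C)"
  by (simp add: power_steps_def)

text \<open>Since \<open>p * C \<le> 1\<close>, each factor is at least
  \<open>(k + C) / (k + 1 + C)\<close>. These telescope to \<open>C / (k + C)\<close>, a harmonic
  minorant.\<close>

lemma not_summable_power_steps:
  assumes p: "0 < p" "p \<le> 1" and C: "0 < C" "C \<le> 1 / p"
  shows "\<not> summable (\<lambda>k. \<Prod>j=1..k. 1 - p * power_steps C 1 j)"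
proof
  assume sum: "summable (\<lambda>k. \<Prod>j=1..k. 1 - p * power_steps C 1 j)"
  have pC: "p * C \<le> 1" using p C by (simp add: field_simps)
  have lower: "C / (real k + C) \<le> (\<Prod>j=1..k. 1 - p * power_steps C 1 j)" for k
  proof (induction k)
    case 0
    then show ?case using C by simp
  next
    case (Suc k)
    have "C / (real (Suc k) + C) = C / (real k + C) * ((real k + C) / (real (Suc k) + C))"
      using C by (simp add: add_pos_nonneg)
    also have "\<dots> \<le> C / (real k + C) * (1 - p * power_steps C 1 (Suc k))"
    proof (rule mult_left_mono)
      have "p * C / (real (Suc k) + C) \<le> 1 / (real (Suc k) + C)"
        using pC C by (intro divide_right_mono) auto
      moreover have "(real k + C) / (real (Suc k) + C) = 1 - 1 / (real (Suc k) + C)"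
        using C by (simp add: field_simps)
      ultimately show "(real k + C) / (real (Suc k) + C) \<le> 1 - p * power_steps C 1 (Suc k)"
        using C by (simp add: power_steps_one)
    qed (use C in simp)
    also have "\<dots> \<le> (\<Prod>j=1..k. 1 - p * power_steps C 1 j) * (1 - p * power_steps C 1 (Suc k))"
    proof (rule mult_right_mono[OF Suc])
      show "0 \<le> 1 - p * power_steps C 1 (Suc k)"
        using shrink_factor_pos[of p "power_steps C 1 (Suc k)"] power_steps_bounds[OF C(1), of 1 "Suc k"] p by simp
    qed
    also have "\<dots> = (\<Prod>j=1..Suc k. 1 - p * power_steps C 1 j)" by simp
    finally show ?case .
  qed
  have "summable (\<lambda>k. C / (1 + C) * inverse (real (Suc k)))"
  proof (rule summable_comparison_test'[OF sum, where N = 0])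
    fix k
    have "0 < real k + C" "real k + C \<le> (1 + C) * real (Suc k)"
      using C by (simp_all add: algebra_simps)
    then have "C / ((1 + C) * real (Suc k)) \<le> C / (real k + C)"
      using C by (intro frac_le) auto
    then have "C / ((1 + C) * real (Suc k)) \<le> (\<Prod>j=1..k. 1 - p * power_steps C 1 j)"
      using lower[of k] by (rule order_trans)
    moreover have "norm (C / (1 + C) * inverse (real (Suc k))) = C / ((1 + C) * real (Suc k))"
      using C by (simp add: field_simps)
    ultimately show "norm (C / (1 + C) * inverse (real (Suc k))) \<le> (\<Prod>j=1..k. 1 - p * power_steps C 1 j)"
      by simp
  qed
  then have "summable (\<lambda>k. (1 + C) / C * (C / (1 + C) * inverse (real (Suc k))))" by (rule summable_mult)
  then have "summable (\<lambda>k. inverse (real (Suc k)))" using C by simp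
  then show False using not_summable_harmonic[where 'a = real] by (subst (asm) summable_Suc_iff) simp
qed

section \<open>Tools for asymptotics: Stolz-Cesaro and logarithmic series\<close>

lemma stolz_cesaro:
  fixes d a :: "nat \<Rightarrow> real"
  assumes inc: "\<forall>\<^sub>F n in sequentially. a n < a (Suc n)" and top: "filterlim a at_top at_top"
    and lim: "(\<lambda>n. d (Suc n) / (a (Suc n) - a n)) \<longlonglongrightarrow> l"
  shows "(\<lambda>n. (\<Sum>k=1..n. d k) / a n) \<longlonglongrightarrow> l"
proof (rule LIMSEQ_I)
  fix r :: real assume r: "0 < r"
  define \<epsilon> where "\<epsilon> = r / 2"
  have \<epsilon>: "\<epsilon> > 0" using r by (simp add: \<epsilon>_def)
  \<comment> \<open>The deviation from the claimed limit: eventually its increments are at most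
    \<open>\<epsilon>\<close> times those of \<open>a\<close>, and the initial value is negligible
    as \<open>a\<close> tends to infinity.\<close>
  define T where "T n = (\<Sum>k=1..n. d k) - l * a n" for n
  have "\<forall>\<^sub>F n in sequentially. dist (d (Suc n) / (a (Suc n) - a n)) l < \<epsilon>"
    using lim \<epsilon> by (rule tendstoD)
  moreover have "\<forall>\<^sub>F n in sequentially. 1 \<le> a n" using top by (simp add: filterlim_at_top)
  ultimately have "\<forall>\<^sub>F n in sequentially. a n < a (Suc n) \<and> 1 \<le> a n \<and> dist (d (Suc n) / (a (Suc n) - a n)) l < \<epsilon>"
    using inc by eventually_elim auto
  then obtain N where N: "\<And>n. n \<ge> N \<Longrightarrow> a n < a (Suc n) \<and> 1 \<le> a n \<and> dist (d (Suc n) / (a (Suc n) - a n)) l < \<epsilon>"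
    by (auto simp: eventually_sequentially)
  have step: "\<bar>T (Suc n) - T n\<bar> \<le> \<epsilon> * (a (Suc n) - a n)" if "n \<ge> N" for n
  proof -
    have pos: "0 < a (Suc n) - a n" using N[OF that] by simp
    have "T (Suc n) - T n = (d (Suc n) / (a (Suc n) - a n) - l) * (a (Suc n) - a n)"
      using pos by (simp add: T_def left_diff_distrib) (simp add: algebra_simps)
    then have "\<bar>T (Suc n) - T n\<bar> = \<bar>d (Suc n) / (a (Suc n) - a n) - l\<bar> * (a (Suc n) - a n)"
      using pos by (simp add: abs_mult)
    also have "\<dots> \<le> \<epsilon> * (a (Suc n) - a n)"
      using N[OF that] pos by (intro mult_right_mono) (auto simp: dist_real_def)
    finally show ?thesis .
  qed
  have T: "\<bar>T (N + j)\<bar> \<le> \<bar>T N\<bar> + \<epsilon> * (a (N + j) - a N)" for j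
  proof (induction j)
    case (Suc j)
    have "\<bar>T (N + Suc j)\<bar> \<le> \<bar>T (N + j)\<bar> + \<bar>T (Suc (N + j)) - T (N + j)\<bar>" by simp
    with Suc step[of "N + j"] show ?case by (simp add: algebra_simps)
  qed simp
  have "\<forall>\<^sub>F n in sequentially. \<bar>T N\<bar> / \<epsilon> < a n" using top by (simp add: filterlim_at_top_dense)
  then obtain N' where N': "\<And>n. n \<ge> N' \<Longrightarrow> \<bar>T N\<bar> / \<epsilon> < a n" by (auto simp: eventually_sequentially)
  show "\<exists>no. \<forall>n\<ge>no. norm ((\<Sum>k=1..n. d k) / a n - l) < r"
  proof (intro exI[of _ "max N N'"] allI impI)
    fix n assume n: "max N N' \<le> n"
    then have an: "1 \<le> a n" "1 \<le> a N" using N[of n] N[of N] by auto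
    have "\<bar>T n\<bar> \<le> \<bar>T N\<bar> + \<epsilon> * (a n - a N)" using T[of "n - N"] n by simp
    also have "\<dots> \<le> \<bar>T N\<bar> + \<epsilon> * a n" using \<epsilon> an by (simp add: algebra_simps)
    also have "\<bar>T N\<bar> < \<epsilon> * a n" using N'[of n] n \<epsilon> by (simp add: field_simps)
    finally have "\<bar>T n\<bar> < r * a n" by (simp add: \<epsilon>_def)
    moreover have "(\<Sum>k=1..n. d k) / a n - l = T n / a n" using an by (simp add: T_def field_simps)
    ultimately show "norm ((\<Sum>k=1..n. d k) / a n - l) < r" using an by (simp add: abs_divide pos_divide_less_eq)
  qed
qed

lemma summable_inverse_log_powr_iff:
  fixes \<beta> :: real
  assumes "0 < \<beta>"
  shows "summable (\<lambda>n. 1 / (real n * ln (real n) powr \<beta>)) \<longleftrightarrow> \<beta> > 1"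
proof -
  \<comment> \<open>At n = 1 the original term is 0, as division by \<open>ln 1 = 0\<close> yields
    0, so the sequence is not decreasing from 1 on. Truncating the argument of the logarithm
    restores the monotonicity that condensation requires.\<close>
  define f where "f n = 1 / (real n * ln (real (max 2 n)) powr \<beta>)" for n
  have "summable (\<lambda>n. 1 / (real n * ln (real n) powr \<beta>)) \<longleftrightarrow> summable f"
    by (intro summable_cong eventually_mono[OF eventually_ge_at_top[of 2]]) (auto simp: f_def max_def)
  also have "\<dots> \<longleftrightarrow> summable (\<lambda>n. 2 ^ n * f (2 ^ n))"
  proof (rule condensation_test)
    fix m :: nat assume m: "0 < m"
    have "ln (real (max 2 m)) powr \<beta> \<le> ln (real (max 2 (Suc m))) powr \<beta>"
      using assms by (intro powr_mono2) auto
    moreover have "0 < ln (real (max 2 m)) powr \<beta>" by simp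
    ultimately show "f (Suc m) \<le> f m"
      unfolding f_def using m by (intro divide_left_mono mult_mono mult_pos_pos) auto
  qed (simp add: f_def)
  also have "\<dots> \<longleftrightarrow> summable (\<lambda>n. (1 / ln 2 powr \<beta>) * real n powr - \<beta>)"
  proof (intro summable_cong eventually_mono[OF eventually_ge_at_top[of 1]])
    fix n :: nat assume n: "1 \<le> n"
    have "(2::nat) \<le> 2 ^ n" using n by (simp add: self_le_power)
    then have "max 2 (2 ^ n) = (2 ^ n :: nat)" by simp
    then show "2 ^ n * f (2 ^ n) = (1 / ln 2 powr \<beta>) * real n powr - \<beta>"
      by (simp add: f_def ln_realpow powr_mult powr_minus divide_simps)
  qed
  also have "\<dots> \<longleftrightarrow> summable (\<lambda>n. real n powr - \<beta>)"
    by (rule summable_cmult_iff[THEN trans]) simp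
  also have "\<dots> \<longleftrightarrow> \<beta> > 1" by (auto simp: summable_real_powr_iff)
  finally show ?thesis .
qed

text \<open>Both the sequence and its reciprocal converge, so both are bounded; the bounds hold from
  index 1 on and not merely eventually.\<close>

lemma ex_pos_bounds:
  fixes f :: "nat \<Rightarrow> real"
  assumes pos: "\<And>k. k \<ge> 1 \<Longrightarrow> 0 < f k" and lim: "f \<longlonglongrightarrow> l" and l: "0 < l"
  shows "\<exists>c>0. \<exists>D>0. \<forall>k\<ge>1. c \<le> f k \<and> f k \<le> D"
proof -
  have "(\<lambda>k. inverse (f k)) \<longlonglongrightarrow> inverse l" using lim l by (intro tendsto_inverse) auto
  then have "Bseq f" "Bseq (\<lambda>k. inverse (f k))" using lim by (auto intro: convergentI convergent_imp_Bseq)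
  then obtain D c where D: "0 < D" "\<And>k. norm (f k) \<le> D" and c: "0 < c" "\<And>k. norm (inverse (f k)) \<le> c"
    unfolding Bseq_def by blast
  have "inverse c \<le> f k" if "k \<ge> 1" for k
    using c(2)[of k] pos[OF that] c(1) by (simp add: field_simps)
  moreover have "f k \<le> D" for k using D(2)[of k] by simp
  ultimately show ?thesis using c(1) D(1) by (intro exI[of _ "inverse c"] conjI exI[of _ D]) auto
qed

lemma not_summable_of_ge_harmonic:
  fixes g :: "nat \<Rightarrow> real"
  assumes c: "0 < c" and ge: "\<And>k. k \<ge> 1 \<Longrightarrow> c / real k \<le> g k"
  shows "\<not> summable (\<lambda>n. g (Suc n))"
proof
  assume "summable (\<lambda>n. g (Suc n))"
  then have "summable (\<lambda>n. c * inverse (real (Suc n)))"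
    by (rule summable_comparison_test'[where N = 0]) (use c ge[of "Suc _"] in \<open>simp add: divide_inverse\<close>)
  then have "summable (\<lambda>n. inverse (real (Suc n)))" using c by (simp add: summable_cmult_iff)
  then show False using not_summable_harmonic[where 'a = real] by (subst (asm) summable_Suc_iff) simp
qed

section \<open>Steps defined by weights with a logarithmic factor\<close>

locale log_weighted =
  fixes p C \<alpha> :: real and \<Delta> :: "nat \<Rightarrow> real"
  assumes p: "0 < p" "p \<le> 1" and C: "0 < C" and \<alpha>: "0 < \<alpha>" and weights: "log_weights p C \<alpha> \<Delta>"
begin

definition S :: "nat \<Rightarrow> real" where "S n = 1 + (\<Sum>k=1..n. \<Delta> k)"

abbreviation g :: "nat \<Rightarrow> real" where "g \<equiv> weight_steps \<Delta>"

abbreviation growth :: "nat \<Rightarrow> real" where "growth n \<equiv> real n powr (1 / p) * ln (real n) powr \<alpha>"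

lemma \<Delta>_pos: "n \<ge> 1 \<Longrightarrow> 0 < \<Delta> n"
  using weights by (simp add: log_weights_def)

lemma S_ge_1: "1 \<le> S n"
proof -
  have "0 \<le> (\<Sum>k=1..n. \<Delta> k)" using \<Delta>_pos by (intro sum_nonneg) (simp add: less_imp_le)
  then show ?thesis by (simp add: S_def)
qed

lemma S_Suc: "S (Suc n) = S n + \<Delta> (Suc n)"
  by (simp add: S_def)

lemma g_eq: "g n = \<Delta> n / S n"
  by (simp add: weight_steps_def S_def)

text \<open>The products of \<open>1 - g j\<close> thus telescope to \<open>1 / S k\<close>, which
  suggests comparing the products of \<open>1 - p * g j\<close> with
  \<open>S k powr - p\<close>.\<close>

lemma one_minus_g: "1 - g (Suc n) = S n / S (Suc n)"
  using S_ge_1[of "Suc n"] by (simp add: g_eq S_Suc field_simps)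

lemma g_bounds:
  assumes "n \<ge> 1"
  shows "0 < g n" "g n < 1"
proof -
  obtain m where m: "n = Suc m" using assms by (cases n) auto
  show "0 < g n" using \<Delta>_pos[OF assms] S_ge_1[of n] by (simp add: g_eq)
  have "0 < S m / S (Suc m)" using S_ge_1[of m] S_ge_1[of "Suc m"] by (intro divide_pos_pos) linarith+
  then show "g n < 1" using one_minus_g[of m] m by simp
qed

lemma \<Delta>_lim: "(\<lambda>n. \<Delta> n / (C * real n powr (1 / p - 1) * ln (real n) powr \<alpha>)) \<longlonglongrightarrow> 1"
proof (rule asymp_equivD_strong)
  show "\<Delta> \<sim>[sequentially] (\<lambda>n. C * real n powr (1 / p - 1) * ln (real n) powr \<alpha>)"
    using weights by (simp add: log_weights_def)
  show "\<forall>\<^sub>F n in sequentially. \<Delta> n \<noteq> 0 \<or> C * real n powr (1 / p - 1) * ln (real n) powr \<alpha> \<noteq> 0"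
    using eventually_ge_at_top[of 1] by eventually_elim (use \<Delta>_pos in fastforce)
qed

lemma S_lim: "(\<lambda>n. S n / growth n) \<longlonglongrightarrow> C * p"
proof -
  define r where "r = 1 / p"
  have r: "0 < r" using p by (simp add: r_def)
  have top: "filterlim growth at_top at_top"
    using r \<alpha> unfolding r_def[symmetric] by real_asymp
  have "\<forall>\<^sub>F n in sequentially. growth n < growth (Suc n)"
    using eventually_ge_at_top[of 1]
  proof eventually_elim
    case (elim n)
    have "real n powr (1 / p) < real (Suc n) powr (1 / p)" using elim p by (intro powr_less_mono2) auto
    moreover have "ln (real n) powr \<alpha> < ln (real (Suc n)) powr \<alpha>" using elim \<alpha> by (intro powr_less_mono2) auto
    ultimately show ?case by (intro mult_strict_mono) auto
  qed
  moreover have "(\<lambda>n. \<Delta> (Suc n) / (growth (Suc n) - growth n)) \<longlonglongrightarrow> C * p"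
  proof -
    \<comment> \<open>By the mean value theorem the increments of \<open>growth\<close> are
      asymptotic to r times the power of n and of the logarithm in the weights; hence the factor
      \<open>p\<close> in the limit.\<close>
    have "(\<lambda>n. real (Suc n) powr (r - 1) * ln (real (Suc n)) powr \<alpha> /
        (real (Suc n) powr r * ln (real (Suc n)) powr \<alpha> - real n powr r * ln (real n) powr \<alpha>)) \<longlonglongrightarrow> inverse r"
      using r \<alpha> by real_asymp
    from tendsto_mult[OF LIMSEQ_Suc[OF \<Delta>_lim] tendsto_mult[OF tendsto_const[of C] this]]
    have "(\<lambda>n. \<Delta> (Suc n) / (C * real (Suc n) powr (1 / p - 1) * ln (real (Suc n)) powr \<alpha>) *
        (C * (real (Suc n) powr (1 / p - 1) * ln (real (Suc n)) powr \<alpha> / (growth (Suc n) - growth n)))) \<longlonglongrightarrow> 1 * (C * p)"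
      by (simp add: r_def)
    moreover have "\<forall>\<^sub>F n in sequentially. \<Delta> (Suc n) / (C * real (Suc n) powr (1 / p - 1) * ln (real (Suc n)) powr \<alpha>) *
        (C * (real (Suc n) powr (1 / p - 1) * ln (real (Suc n)) powr \<alpha> / (growth (Suc n) - growth n)))
        = \<Delta> (Suc n) / (growth (Suc n) - growth n)"
      using eventually_ge_at_top[of 1] by eventually_elim (use C in auto)
    ultimately show ?thesis unfolding mult_1_left by (rule Lim_transform_eventually)
  qed
  ultimately have sum: "(\<lambda>n. (\<Sum>k=1..n. \<Delta> k) / growth n) \<longlonglongrightarrow> C * p"
    using top by (intro stolz_cesaro)
  have "(\<lambda>n. 1 / growth n) \<longlonglongrightarrow> 0"
    using r \<alpha> unfolding r_def[symmetric] by real_asymp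
  from tendsto_add[OF this sum] show ?thesis by (simp add: S_def add_divide_distrib)
qed

lemma g_lim: "(\<lambda>n. real n * g n) \<longlonglongrightarrow> 1 / p"
proof -
  have Cp: "C * p \<noteq> 0" using C p by simp
  have "(\<lambda>n. C * (\<Delta> n / (C * real n powr (1 / p - 1) * ln (real n) powr \<alpha>) / (S n / growth n))) \<longlonglongrightarrow> C * (1 / (C * p))"
    by (intro tendsto_mult tendsto_const tendsto_divide \<Delta>_lim S_lim Cp)
  moreover have "\<forall>\<^sub>F n in sequentially.
      C * (\<Delta> n / (C * real n powr (1 / p - 1) * ln (real n) powr \<alpha>) / (S n / growth n)) = real n * g n"
    using eventually_ge_at_top[of 2]
  proof eventually_elim
    case (elim n)
    have "real n powr (1 / p) = real n * real n powr (1 / p - 1)"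
      using elim by (simp add: powr_diff)
    moreover have "0 < ln (real n) powr \<alpha>" "0 < real n powr (1 / p - 1)" using elim by auto
    ultimately show ?case using C S_ge_1[of n] by (simp add: g_eq field_simps)
  qed
  ultimately have "(\<lambda>n. real n * g n) \<longlonglongrightarrow> C * (1 / (C * p))" by (rule Lim_transform_eventually)
  then show ?thesis using C by simp
qed

lemma g_asymp: "g \<sim>[at_top] (\<lambda>n. 1 / (real n * p))"
proof (rule asymp_equivI')
  have "(\<lambda>n. p * (real n * g n)) \<longlonglongrightarrow> p * (1 / p)" by (intro tendsto_mult tendsto_const g_lim)
  then show "(\<lambda>n. g n / (1 / (real n * p))) \<longlonglongrightarrow> 1" using p by (simp add: mult_ac)
qed

lemma g_ex_bounds:
  "\<exists>c>0. \<exists>D>0. \<forall>k\<ge>1. c / real k \<le> g k \<and> g k \<le> D / real k"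
proof -
  have "\<exists>c>0. \<exists>D>0. \<forall>k\<ge>1. c \<le> real k * g k \<and> real k * g k \<le> D"
    using g_bounds g_lim p by (intro ex_pos_bounds[where l = "1 / p"]) auto
  then obtain c D where "0 < c" "0 < D" "\<And>k. k \<ge> 1 \<Longrightarrow> c \<le> real k * g k \<and> real k * g k \<le> D" by blast
  then show ?thesis by (intro exI[of _ c] conjI exI[of _ D]) (auto simp: field_simps)
qed

lemma g_admissible: "admissible_steps g"
proof -
  obtain c where c: "0 < c" "\<And>k. k \<ge> 1 \<Longrightarrow> c / real k \<le> g k" using g_ex_bounds by blast
  have "filterlim (\<lambda>n. \<Sum>k<n. g (Suc k)) at_top at_top"
    using g_bounds by (intro filterlim_partial_sums_at_top not_summable_of_ge_harmonic[OF c]) (auto intro: less_imp_le)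
  also have "(\<lambda>n. \<Sum>k<n. g (Suc k)) = (\<lambda>n. \<Sum>k=1..n. g k)"
    by (simp add: sum.atLeast1_atMost_eq)
  finally show ?thesis using g_bounds by (auto simp: admissible_steps_def)
qed

text \<open>Concavity of the power, here as the weighted mean inequality for \<open>1 - g\<close>
  and 1, gives \<open>(1 - g) powr p \<le> 1 - p * g\<close>; the left sides telescope.\<close>

lemma products_ge: "S k powr - p \<le> (\<Prod>j=1..k. 1 - p * g j)"
proof (induction k)
  case 0
  then show ?case by (simp add: S_def)
next
  case (Suc k)
  have S: "0 < S k" "0 < S (Suc k)" using S_ge_1[of k] S_ge_1[of "Suc k"] by auto
  have "(1 - g (Suc k)) powr p * 1 powr (1 - p) \<le> p * (1 - g (Suc k)) + (1 - p) * 1"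
    using p g_bounds[of "Suc k"] by (intro Youngs_inequality_0) auto
  then have "(1 - g (Suc k)) powr p \<le> 1 - p * g (Suc k)" by (simp add: algebra_simps)
  then have "S k powr - p * (1 - g (Suc k)) powr p \<le> (\<Prod>j=1..k. 1 - p * g j) * (1 - p * g (Suc k))"
    using Suc order_trans[OF powr_ge_zero Suc] by (intro mult_mono) auto
  moreover have "S k powr - p * (1 - g (Suc k)) powr p = S (Suc k) powr - p"
    using S by (simp add: one_minus_g powr_divide powr_minus divide_simps)
  ultimately show ?case by simp
qed

text \<open>The converse comparison loses only a bounded factor. From
  \<open>ln (1 / (1 - h)) \<le> h / (1 - h) = h + h^2 / (1 - h)\<close> one gets
  \<open>1 - p * h \<le> exp (p * q k) * (1 - h) powr p\<close>, and the \<open>q k\<close> are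
  summable because the steps are of order \<open>1 / k\<close>.\<close>

lemma products_le: "\<exists>K>0. \<forall>k. (\<Prod>j=1..k. 1 - p * g j) \<le> K * S k powr - p"
proof -
  define q where "q j = (g (Suc j))\<^sup>2 / (1 - g (Suc j))" for j
  obtain D where D: "0 < D" "\<And>k. k \<ge> 1 \<Longrightarrow> g k \<le> D / real k" using g_ex_bounds by blast
  have q0: "0 \<le> q j" for j using g_bounds[of "Suc j"] by (simp add: q_def)
  have "summable q"
  proof (rule summable_comparison_test_ev)
    show "summable (\<lambda>j. 2 * D\<^sup>2 * inverse ((real (Suc j))\<^sup>2))"
      by (intro summable_mult) (subst summable_Suc_iff, rule inverse_power_summable, simp)
    have "\<forall>\<^sub>F j in sequentially. real (Suc j) \<ge> 2 * D" by real_asymp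
    then show "\<forall>\<^sub>F j in sequentially. norm (q j) \<le> 2 * D\<^sup>2 * inverse ((real (Suc j))\<^sup>2)"
    proof eventually_elim
      case (elim j)
      have le: "g (Suc j) \<le> D / real (Suc j)" using D(2) by (metis le_add1 plus_1_eq_Suc)
      have half: "D / real (Suc j) \<le> 1 / 2" using elim by (simp add: field_simps)
      have "1 / 2 \<le> 1 - g (Suc j)" using le half by linarith
      then have "q j \<le> (g (Suc j))\<^sup>2 / (1 / 2)"
        unfolding q_def by (intro divide_left_mono) auto
      also have "\<dots> \<le> 2 * (D / real (Suc j))\<^sup>2"
        using le g_bounds[of "Suc j"] by (simp add: power_mono)
      also have "\<dots> = 2 * D\<^sup>2 * inverse ((real (Suc j))\<^sup>2)"
        by (simp only: divide_inverse power_mult_distrib power_inverse mult.assoc)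
      finally show ?case using q0[of j] by (simp only: real_norm_def abs_of_nonneg)
    qed
  qed
  then have sum: "(\<Sum>j<k. q j) \<le> suminf q" for k using q0 by (intro sum_le_suminf) auto
  have le: "(\<Prod>j=1..k. 1 - p * g j) \<le> exp (p * (\<Sum>j<k. q j)) * S k powr - p" for k
  proof (induction k)
    case 0
    then show ?case by (simp add: S_def)
  next
    case (Suc k)
    define h where "h = g (Suc k)"
    have h: "0 < h" "h < 1" using g_bounds[of "Suc k"] by (auto simp: h_def)
    have S: "0 < S k" "0 < S (Suc k)" using S_ge_1[of k] S_ge_1[of "Suc k"] by auto
    have "ln (1 / (1 - h)) \<le> 1 / (1 - h) - 1" using h by (intro ln_le_minus_one) auto
    also have "1 / (1 - h) - 1 = h + q k" using h by (simp add: q_def h_def[symmetric] field_simps power2_eq_square)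
    finally have "- h \<le> ln (1 - h) + q k" using h by (simp add: ln_div)
    then have "p * (- h) \<le> p * (ln (1 - h) + q k)" using p by (intro mult_left_mono) auto
    then have "exp (- (p * h)) \<le> exp (p * q k + p * ln (1 - h))" by (simp add: algebra_simps)
    moreover have "1 - p * h \<le> exp (- (p * h))" using exp_ge_add_one_self[of "- (p * h)"] by simp
    ultimately have step: "1 - p * h \<le> exp (p * q k) * (1 - h) powr p"
      using h by (simp add: exp_add powr_def)
    have pos: "0 \<le> 1 - p * h" using shrink_factor_pos[of p h] p h by simp
    have "(\<Prod>j=1..Suc k. 1 - p * g j) = (\<Prod>j=1..k. 1 - p * g j) * (1 - p * h)" by (simp add: h_def)
    also have "\<dots> \<le> (exp (p * (\<Sum>j<k. q j)) * S k powr - p) * (exp (p * q k) * (1 - h) powr p)"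
      using Suc step pos by (intro mult_mono) auto
    also have "\<dots> = exp (p * (\<Sum>j<Suc k. q j)) * (S k powr - p * (1 - h) powr p)"
      by (simp add: distrib_left exp_add)
    also have "S k powr - p * (1 - h) powr p = S (Suc k) powr - p"
      using S by (simp add: h_def one_minus_g powr_divide powr_minus divide_simps)
    finally show ?case .
  qed
  have "(\<Prod>j=1..k. 1 - p * g j) \<le> exp (p * suminf q) * S k powr - p" for k
    using le[of k] sum[of k] p by (smt (verit) exp_le_cancel_iff mult_left_mono mult_right_mono powr_ge_zero)
  then show ?thesis by (intro exI[of _ "exp (p * suminf q)"]) auto
qed

text \<open>Raising \<open>n powr (1 / p)\<close> to the power \<open>- p\<close> leaves exactly
  \<open>1 / n\<close>, so only the logarithm can decide convergence.\<close>

lemma S_powr_bounds: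
  "\<exists>a>0. \<forall>\<^sub>F n in sequentially. a * (1 / (real n * ln (real n) powr (\<alpha> * p))) \<le> S n powr - p"
  "\<exists>b>0. \<forall>\<^sub>F n in sequentially. S n powr - p \<le> b * (1 / (real n * ln (real n) powr (\<alpha> * p)))"
proof -
  have Cp: "0 < C * p" using C p by simp
  have ev: "\<forall>\<^sub>F n in sequentially. C * p / 2 < S n / growth n" "\<forall>\<^sub>F n in sequentially. S n / growth n < 2 * (C * p)"
    using order_tendstoD(1)[OF S_lim, of "C * p / 2"] order_tendstoD(2)[OF S_lim, of "2 * (C * p)"] Cp by auto
  have eq: "(t * growth n) powr - p = t powr - p * (1 / (real n * ln (real n) powr (\<alpha> * p)))"
    if "n \<ge> 2" "0 < t" for n t
  proof -
    have "(t * growth n) powr - p = t powr - p * (growth n) powr - p"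
      by (rule powr_mult)
    also have "(growth n) powr - p = 1 / (real n * ln (real n) powr (\<alpha> * p))"
      using that p by (simp add: powr_minus powr_mult powr_powr divide_inverse)
    finally show ?thesis .
  qed
  show "\<exists>a>0. \<forall>\<^sub>F n in sequentially. a * (1 / (real n * ln (real n) powr (\<alpha> * p))) \<le> S n powr - p"
  proof (intro exI[of _ "(2 * (C * p)) powr - p"] conjI)
    show "\<forall>\<^sub>F n in sequentially. (2 * (C * p)) powr - p * (1 / (real n * ln (real n) powr (\<alpha> * p))) \<le> S n powr - p"
      using ev(2) eventually_ge_at_top[of 2]
    proof eventually_elim
      case (elim n)
      have "0 < growth n" using elim by auto
      then have "S n \<le> 2 * (C * p) * growth n" using elim by (simp add: pos_divide_less_eq)
      then have "(2 * (C * p) * growth n) powr - p \<le> S n powr - p"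
        using S_ge_1[of n] p by (intro powr_mono2') auto
      then show ?case using eq[of n "2 * (C * p)"] elim Cp by simp
    qed
  qed (use C p in simp)
  show "\<exists>b>0. \<forall>\<^sub>F n in sequentially. S n powr - p \<le> b * (1 / (real n * ln (real n) powr (\<alpha> * p)))"
  proof (intro exI[of _ "(C * p / 2) powr - p"] conjI)
    show "\<forall>\<^sub>F n in sequentially. S n powr - p \<le> (C * p / 2) powr - p * (1 / (real n * ln (real n) powr (\<alpha> * p)))"
      using ev(1) eventually_ge_at_top[of 2]
    proof eventually_elim
      case (elim n)
      have sc: "0 < growth n" using elim by auto
      then have "C * p / 2 * growth n \<le> S n" using elim by (simp add: pos_less_divide_eq)
      then have "S n powr - p \<le> (C * p / 2 * growth n) powr - p"
        using sc Cp p by (intro powr_mono2') auto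
      then show ?case using eq[of n "C * p / 2"] elim Cp by simp
    qed
  qed (use C p in simp)
qed

lemma summable_products_iff: "summable (\<lambda>k. \<Prod>j=1..k. 1 - p * g j) \<longleftrightarrow> \<alpha> > 1 / p"
proof -
  let ?P = "\<lambda>k. \<Prod>j=1..k. 1 - p * g j" and ?r = "\<lambda>n. 1 / (real n * ln (real n) powr (\<alpha> * p))"
  obtain a b where ab: "0 < a" "0 < b" "\<forall>\<^sub>F n in sequentially. a * ?r n \<le> S n powr - p"
    "\<forall>\<^sub>F n in sequentially. S n powr - p \<le> b * ?r n" using S_powr_bounds by blast
  obtain K where K: "0 < K" "\<And>k. ?P k \<le> K * S k powr - p" using products_le by blast
  have P0: "0 \<le> ?P k" for k
    using order_trans[OF _ products_ge[of k]] by simp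
  have "summable ?P \<longleftrightarrow> summable ?r"
  proof
    assume P: "summable ?P"
    have "\<forall>\<^sub>F n in sequentially. norm (a * ?r n) \<le> ?P n"
      using ab(3) eventually_ge_at_top[of 1]
      by eventually_elim (use ab(1) products_ge order_trans in \<open>force simp: abs_mult\<close>)
    from summable_comparison_test_ev[OF this P] show "summable ?r"
      using ab(1) by (subst (asm) summable_cmult_iff) auto
  next
    assume r: "summable ?r"
    have "\<forall>\<^sub>F n in sequentially. norm (?P n) \<le> K * b * ?r n"
      using ab(4)
    proof eventually_elim
      case (elim n)
      have "?P n \<le> K * S n powr - p" by (rule K)
      also have "\<dots> \<le> K * (b * ?r n)" using elim K by (intro mult_left_mono) auto
      finally show ?case using P0[of n] by simp
    qed
    from summable_comparison_test_ev[OF this summable_mult[OF r]] show "summable ?P" .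
  qed
  also have "\<dots> \<longleftrightarrow> \<alpha> * p > 1" using \<alpha> p by (intro summable_inverse_log_powr_iff) auto
  also have "\<dots> \<longleftrightarrow> \<alpha> > 1 / p" using p by (simp add: field_simps)
  finally show ?thesis .
qed

end

section \<open>Infallibility\<close>

text \<open>In the summable case one small starting point suffices, since the criterion quantifies
  over all of them. Elsewhere the two-sided bound by multiples of \<open>1 / k\<close> controls both
  the squared steps and the state right after a win.\<close>

lemma (in bandit_environment) zero_limit_dichotomy:
  assumes p: "0 < pB" "pB \<le> pA"
    and g: "\<And>k. k \<ge> 1 \<Longrightarrow> 0 < \<gamma> k \<and> \<gamma> k < 1"
  shows "summable (\<lambda>k. \<Prod>j=1..k. 1 - pB * \<gamma> j) \<Longrightarrow>
      \<exists>x\<in>{0<..1}. prob {\<omega> \<in> space M. bandit_limit \<gamma> U A B x \<omega> = 0} \<noteq> 0"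
    and "\<not> summable (\<lambda>k. \<Prod>j=1..k. 1 - pB * \<gamma> j) \<Longrightarrow> 0 < c \<Longrightarrow> 0 < D \<Longrightarrow>
      (\<And>k. k \<ge> 1 \<Longrightarrow> c / real k \<le> \<gamma> k) \<Longrightarrow> (\<And>k. k \<ge> 1 \<Longrightarrow> \<gamma> k \<le> D / real k) \<Longrightarrow>
      x \<in> {0<..1} \<Longrightarrow> prob {\<omega> \<in> space M. bandit_limit \<gamma> U A B x \<omega> = 0} = 0"
    and "\<not> summable (\<lambda>k. \<Prod>j=1..k. 1 - pB * \<gamma> j) \<Longrightarrow> 0 < c \<Longrightarrow> 0 < D \<Longrightarrow>
      (\<And>k. k \<ge> 1 \<Longrightarrow> c / real k \<le> \<gamma> k) \<Longrightarrow> (\<And>k. k \<ge> 1 \<Longrightarrow> \<gamma> k \<le> D / real k) \<Longrightarrow>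
      pB < pA \<Longrightarrow> infallible M \<gamma> U A B"
proof -
  have proc: "bandit_process M U A B pA pB \<gamma> x" if "x \<in> {0<..1}" for x
    using g that by unfold_locales auto
  {
    assume sum: "summable (\<lambda>k. \<Prod>j=1..k. 1 - pB * \<gamma> j)"
    let ?s = "\<Sum>k. \<Prod>j=1..k. 1 - pB * \<gamma> j"
    \<comment> \<open>Small enough that \<open>x * ?s\<close> is at most 1/2; the maximum keeps x in
      (0,1].\<close>
    define x where "x = 1 / (2 * max 1 ?s)"
    have x: "x \<in> {0<..1}" by (auto simp: x_def)
    have "x * ?s \<le> x * max 1 ?s" using x by (intro mult_left_mono) auto
    also have "\<dots> = 1 / 2" by (simp add: x_def max_def)
    finally show "\<exists>x\<in>{0<..1}. prob {\<omega> \<in> space M. bandit_limit \<gamma> U A B x \<omega> = 0} \<noteq> 0"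
      using bandit_process.prob_limit_zero_pos[OF proc[OF x] sum] x by blast
  }
  assume a: "\<not> summable (\<lambda>k. \<Prod>j=1..k. 1 - pB * \<gamma> j)" "0 < c" "0 < D"
    "\<And>k. k \<ge> 1 \<Longrightarrow> c / real k \<le> \<gamma> k" "\<And>k. k \<ge> 1 \<Longrightarrow> \<gamma> k \<le> D / real k"
  show zero: "prob {\<omega> \<in> space M. bandit_limit \<gamma> U A B x \<omega> = 0} = 0" if x: "x \<in> {0<..1}" for x
    using bandit_process.prob_limit_zero_null[OF proc[OF x] p a(2) _ a(3) _ a(1)] a(4,5) by blast
  assume "pB < pA"
  then show "infallible M \<gamma> U A B"
    unfolding infallible_def
    using bandit_process.prob_limit_one[OF proc _ bandit_process.AE_convergent_biased[OF proc] zero]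
      not_summable_of_ge_harmonic[OF a(2,4)] by blast
qed

theorem corollary2:
  fixes M :: "'a measure"
    and U :: "nat \<Rightarrow> 'a \<Rightarrow> real"
    and A B :: "nat \<Rightarrow> 'a set"
    and pA pB :: real
  assumes env: "bandit_environment M U A B pA pB"
    and pB_pos: "0 < pB" and pB_le_pA: "pB \<le> pA" and pA_le_1: "pA \<le> 1"
  shows "(\<forall>\<alpha> C. 0 < \<alpha> \<and> \<alpha> \<le> 1 \<and> 0 < C \<longrightarrow>
      ((\<forall>x\<in>{0<..1}.
          measure M {\<omega> \<in> space M. bandit_limit (power_steps C \<alpha>) U A B x \<omega> = 0} = 0)
        \<longleftrightarrow> \<alpha> = 1 \<and> C \<le> 1 / pB)) \<and>
    (\<forall>\<alpha> C \<Delta>. 0 < \<alpha> \<and> 0 < C \<and> log_weights pB C \<alpha> \<Delta> \<longrightarrow>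
      admissible_steps (weight_steps \<Delta>) \<and>
      weight_steps \<Delta> \<sim>[at_top] (\<lambda>n. 1 / (real n * pB)) \<and>
      ((\<forall>x\<in>{0<..1}.
          measure M {\<omega> \<in> space M. bandit_limit (weight_steps \<Delta>) U A B x \<omega> = 0} = 0)
        \<longleftrightarrow> \<alpha> \<le> 1 / pB)) \<and>
    (pB < pA \<longrightarrow>
      (\<forall>C. 0 < C \<and> C \<le> 1 / pB \<longrightarrow> infallible M (power_steps C 1) U A B) \<and>
      (\<forall>\<alpha> C \<Delta>. 0 < \<alpha> \<and> 0 < C \<and> log_weights pB C \<alpha> \<Delta> \<and> \<alpha> \<le> 1 / pB \<longrightarrow>
         infallible M (weight_steps \<Delta>) U A B)) \<and>
    (\<forall>n\<ge>1. power_steps 1 1 n = 1 / (real n + 1)) \<and> 1 \<le> 1 / pB"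
proof -
  interpret bandit_environment M U A B pA pB by (rule env)
  have pB1: "pB \<le> 1" using pB_le_pA pA_le_1 by simp
  note zero = zero_limit_dichotomy[OF pB_pos pB_le_pA]
  have power_le: "C / (1 + C) / real k \<le> power_steps C 1 k" "power_steps C 1 k \<le> C / real k"
    if "0 < C" "k \<ge> 1" for C k
  proof -
    \<comment> \<open>For \<open>k \<ge> 1\<close> one has \<open>k + C \<le> (1 + C) * k\<close>,
      which gives a lower constant valid from the first step on.\<close>
    have "C / ((1 + C) * real k) \<le> C / (real k + C)"
      using that mult_left_mono[of 1 "real k" C] by (intro divide_left_mono) (auto simp: algebra_simps add_pos_pos)
    then show "C / (1 + C) / real k \<le> power_steps C 1 k" using that by (simp add: power_steps_one)
    show "power_steps C 1 k \<le> C / real k" using that by (simp add: power_steps_one divide_left_mono)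
  qed
  have power: "(\<forall>x\<in>{0<..1}. measure M {\<omega> \<in> space M. bandit_limit (power_steps C \<alpha>) U A B x \<omega> = 0} = 0)
      \<longleftrightarrow> \<alpha> = 1 \<and> C \<le> 1 / pB" if \<alpha>: "0 < \<alpha>" "\<alpha> \<le> 1" and C: "0 < C" for \<alpha> C
  proof (cases "\<alpha> = 1 \<and> C \<le> 1 / pB")
    case True
    have c: "C / (1 + C) > 0" using C by simp
    have "prob {\<omega> \<in> space M. bandit_limit (power_steps C 1) U A B x \<omega> = 0} = 0" if "x \<in> {0<..1}" for x
      by (rule zero(2)[where \<gamma> = "power_steps C 1", OF _ _ c C])
        (use C True that power_steps_bounds[of C 1] power_le not_summable_power_steps pB_pos pB1 in auto)
    then show ?thesis using True by simp
  next
    case False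
    have "\<exists>x\<in>{0<..1}. prob {\<omega> \<in> space M. bandit_limit (power_steps C \<alpha>) U A B x \<omega> = 0} \<noteq> 0"
      by (rule zero(1)[where \<gamma> = "power_steps C \<alpha>", OF _ summable_power_steps[OF pB_pos pB1 C \<alpha> False]])
        (use power_steps_bounds[OF C \<alpha>(1)] in auto)
    then show ?thesis using False by blast
  qed
  have inf_power: "infallible M (power_steps C 1) U A B" if "pB < pA" "0 < C" "C \<le> 1 / pB" for C
  proof (rule zero(3))
    show "0 < C / (1 + C)" "0 < C" using that by simp_all
  qed (use that power_steps_bounds[of C 1] power_le not_summable_power_steps pB_pos pB1 in auto)
  have lw: "log_weighted pB C \<alpha> \<Delta>" if "0 < \<alpha>" "0 < C" "log_weights pB C \<alpha> \<Delta>" for \<alpha> C \<Delta>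
    using that pB_pos pB1 by unfold_locales
  have weight: "(\<forall>x\<in>{0<..1}. measure M {\<omega> \<in> space M. bandit_limit (weight_steps \<Delta>) U A B x \<omega> = 0} = 0)
      \<longleftrightarrow> \<alpha> \<le> 1 / pB" and inf_weight: "pB < pA \<Longrightarrow> \<alpha> \<le> 1 / pB \<Longrightarrow> infallible M (weight_steps \<Delta>) U A B"
    if "0 < \<alpha>" "0 < C" "log_weights pB C \<alpha> \<Delta>" for \<alpha> C \<Delta>
  proof -
    interpret log_weighted pB C \<alpha> \<Delta> by (rule lw[OF that])
    have g: "\<And>k. k \<ge> 1 \<Longrightarrow> 0 < weight_steps \<Delta> k \<and> weight_steps \<Delta> k < 1" using g_bounds by blast
    obtain c D where cD: "0 < c" "0 < D" "\<And>k. k \<ge> 1 \<Longrightarrow> c / real k \<le> weight_steps \<Delta> k"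
      "\<And>k. k \<ge> 1 \<Longrightarrow> weight_steps \<Delta> k \<le> D / real k" using g_ex_bounds by blast
    have iff: "summable (\<lambda>k. \<Prod>j=1..k. 1 - pB * weight_steps \<Delta> j) \<longleftrightarrow> \<not> \<alpha> \<le> 1 / pB"
      using summable_products_iff by auto
    show "(\<forall>x\<in>{0<..1}. measure M {\<omega> \<in> space M. bandit_limit (weight_steps \<Delta>) U A B x \<omega> = 0} = 0)
      \<longleftrightarrow> \<alpha> \<le> 1 / pB"
    proof (cases "\<alpha> \<le> 1 / pB")
      case True
      then show ?thesis using zero(2)[where \<gamma> = "weight_steps \<Delta>", OF g _ cD] iff by blast
    next
      case False
      then show ?thesis using zero(1)[where \<gamma> = "weight_steps \<Delta>", OF g] iff by blast
    qed
    show "infallible M (weight_steps \<Delta>) U A B" if "pB < pA" "\<alpha> \<le> 1 / pB"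
      using zero(3)[where \<gamma> = "weight_steps \<Delta>", OF g _ cD] iff that by blast
  qed
  show ?thesis
  proof (intro conjI allI impI, goal_cases)
    case (1 \<alpha> C)
    then show ?case by (intro power) auto
  next
    case (2 \<alpha> C \<Delta>)
    then show ?case using log_weighted.g_admissible[OF lw] by blast
  next
    case (3 \<alpha> C \<Delta>)
    then show ?case using log_weighted.g_asymp[OF lw] by blast
  next
    case (4 \<alpha> C \<Delta>)
    then show ?case using weight by blast
  next
    case (5 C)
    then show ?case by (intro inf_power) auto
  next
    case (6 \<alpha> C \<Delta>)
    then show ?case using inf_weight by blast
  next
    case (7 n)
    then show ?case by (simp add: power_steps_one)
  next
    case 8
    then show ?case using pB_pos pB1 by simp
  qed
qed

end
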